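(* Let $\mathbb{K}$ be a field of characteristic zero and let $\mathbf{FQSym}$ be the algebra of free quasi-symmetric functions over $\mathbb{K}$, with basis $(\mathbf{F}_\sigma)$ indexed by all permutations. Let $\mathcal{J}$ be the subspace of $\mathbf{FQSym}$ spanned by all differences $\mathbf{F}_\sigma-\mathbf{F}_\tau$ where $\sigma,\tau$ are permutations of the same size with $\operatorname{GC}(\sigma)=\operatorname{GC}(\tau)$. Then $\mathcal{J}$ is a two-sided ideal of $\mathbf{FQSym}$, and the quotient algebra $\mathbf{T}=\mathbf{FQSym}/\mathcal{J}$ is isomorphic to $\mathbf{Sym}$ as an algebra. Moreover, for a composition $I$, let $T_I$ denote the image in $\mathbf{T}$ of any $\mathbf{F}_\sigma$ with $\operatorname{GC}(\sigma)=I$. Then for compositions $I,J$, $$T_I T_J=\sum_{K} C_{I,J}^K\, T_K,$$ the sum over compositions $K$ of $|I|+|J|$, where $C_{I,J}^K$ is computed as follows. Let $K'$ and $K''$ be the compositions such that $|K'|=|I|$ and either $K=K'\cdot K''$ or $K=K'\triangleright K''$. If $K'$ is not coarser than $I$ or if $K''$ is not finer than $J$, then $C_{I,J}^K=0$. Otherwise $$C_{I,J}^K=\binom{|I|+l(J)-l(I)}{l(K)-l(I)}.$$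
   Context: $\mathbf{FQSym}$ is the $\mathbb{K}$-vector space with basis $\mathbf{F}_\sigma$, $\sigma$ ranging over permutations of all sizes $n\ge 0$, with product $\mathbf{F}_{\sigma'}\mathbf{F}_{\sigma''}=\sum_{\sigma\in \sigma'\Cup\sigma''}\mathbf{F}_\sigma$, where for $\sigma'\in\mathfrak S_m$ (written as a word $\sigma'_1\cdots\sigma'_m$) and $\sigma''\in\mathfrak S_n$, the shifted shuffle $\sigma'\Cup\sigma''$ is the multiset of all shuffles of the word $\sigma'$ with the word $\sigma''[m]$ obtained from $\sigma''$ by adding $m$ to each letter (shuffle defined recursively by $(au)\,⧢\,(bv)=a(u\,⧢\, bv)+b(au\,⧢\, v)$, $u\,⧢\,\epsilon=\epsilon\,⧢\,u=u$). (Equivalently $\mathbf{F}_\sigma=\sum_{\mathrm{Std}(w)=\sigma^{-1}}w$ in the free algebra on an infinite totally ordered alphabet.) $\mathbf{Sym}$ is the free associative $\mathbb{K}$-algebra on noncommuting generators $S_1,S_2,\dots$ with $\deg S_n=n$ (noncommutative symmetric functions). For $\sigma\in\mathfrak S_n$ written as a word $\sigma_1\cdots\sigma_n$, the Genocchi descent set is $\operatorname{GDes}(\sigma)=\{\sigma_j : 1\le j<n,\ \sigma_j>\sigma_{j+1}\}$ (the values, not positions, of descents). The G-composition $\operatorname{GC}(\sigma)$ is the composition of $n$ whose descent set (set of partial sums $i_1+\dots+i_k$, $k<r$, of $(i_1,\dots,i_r)$) equals $\{d-1 : d\in\operatorname{GDes}(\sigma)\}$. E.g. $\operatorname{GC}(21)=(1,1)$,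 $\operatorname{GC}(12)=(2)$, $\operatorname{GC}(132)=(2,1)$. For compositions $A=(a_1,\dots,a_p)$, $B=(b_1,\dots,b_q)$: $A\cdot B=(a_1,\dots,a_p,b_1,\dots,b_q)$ and $A\triangleright B=(a_1,\dots,a_{p-1},a_p+b_1,b_2,\dots,b_q)$. $|A|$ is the sum of parts and $l(A)$ the number of parts. $A$ is coarser than $C$ (equivalently $C$ finer than $A$) if $A$ is obtained by summing consecutive parts of $C$ (a composition is coarser than itself). *)

theory Defs
  imports
    "HOL-Algebra.QuotRing"
    "HOL-Algebra.Module"
    "HOL-Library.Poly_Mapping"
    "HOL-Combinatorics.Multiset_Permutations"
begin

section \<open>Algebras with a basis of words\<close>

text \<open>
  A K-algebra is represented by an \<open>HOL-Algebra\<close> ring with a scalar multiplication,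
  i.e. a record of type \<open>('k, 'v) module\<close>, the scalars being all of a type \<open>'k\<close> of class \<open>field\<close>.
  (The locale \<open>algebra\<close> of the library requires a commutative multiplication, so it does not apply.)
\<close>

definition scale :: "'k::field \<Rightarrow> ('b \<Rightarrow>\<^sub>0 'k) \<Rightarrow> ('b \<Rightarrow>\<^sub>0 'k)" where
  "scale c f = Poly_Mapping.map ((*) c) f"

definition basis :: "'b \<Rightarrow> ('b \<Rightarrow>\<^sub>0 'k::field)" where
  "basis b = Poly_Mapping.single b 1"

definition bilinear_ext ::
    "('b \<Rightarrow> 'b \<Rightarrow> ('b \<Rightarrow>\<^sub>0 'k::field)) \<Rightarrow> ('b \<Rightarrow>\<^sub>0 'k) \<Rightarrow> ('b \<Rightarrow>\<^sub>0 'k) \<Rightarrow> ('b \<Rightarrow>\<^sub>0 'k)" where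
  "bilinear_ext m f g =
    (\<Sum>u\<in>Poly_Mapping.keys f. \<Sum>v\<in>Poly_Mapping.keys g.
       scale (Poly_Mapping.lookup f u * Poly_Mapping.lookup g v) (m u v))"

definition based_algebra ::
    "'b set \<Rightarrow> 'b \<Rightarrow> ('b \<Rightarrow> 'b \<Rightarrow> ('b \<Rightarrow>\<^sub>0 'k::field)) \<Rightarrow> ('k, 'b \<Rightarrow>\<^sub>0 'k) module" where
  "based_algebra B e m =
    \<lparr>carrier = {f. Poly_Mapping.keys f \<subseteq> B},
     monoid.mult = bilinear_ext m, one = basis e, zero = 0, add = (+), smult = scale\<rparr>"

text \<open>
  On a coset \<open>X = I + x\<close> the scalar multiplication of the quotient yields \<open>I + c x\<close>;
  the union runs over all representatives of \<open>X\<close>.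
\<close>

definition quot_algebra :: "('k, 'v) module \<Rightarrow> 'v set \<Rightarrow> ('k, 'v set) module" where
  "quot_algebra A I =
    ring.extend (A Quot I)
      (module.fields (\<lambda>c X. \<Union>x\<in>X. I +>\<^bsub>A\<^esub> (c \<odot>\<^bsub>A\<^esub> x)))"

definition algebra_iso :: "('k, 'v) module \<Rightarrow> ('k, 'w) module \<Rightarrow> ('v \<Rightarrow> 'w) set" where
  "algebra_iso A B =
    {h \<in> ring_iso A B. \<forall>c. \<forall>x\<in>carrier A. h (c \<odot>\<^bsub>A\<^esub> x) = c \<odot>\<^bsub>B\<^esub> h x}"


section \<open>Free quasi-symmetric functions\<close>

definition perms :: "nat list set" where
  "perms = (\<Union>n. permutations_of_set {1..n})"

fun shuffle :: "'a list \<Rightarrow> 'a list \<Rightarrow> 'a list multiset" where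
  "shuffle u [] = {#u#}"
| "shuffle [] v = {#v#}"
| "shuffle (a # u) (b # v) =
     image_mset ((#) a) (shuffle u (b # v)) + image_mset ((#) b) (shuffle (a # u) v)"

definition shifted_shuffle :: "nat list \<Rightarrow> nat list \<Rightarrow> nat list multiset" where
  "shifted_shuffle s t = shuffle s (map (\<lambda>x. x + length s) t)"

definition FQSym :: "('k::field, nat list \<Rightarrow>\<^sub>0 'k) module" where
  "FQSym = based_algebra perms [] (\<lambda>s t. \<Sum>w\<in>#shifted_shuffle s t. basis w)"


section \<open>Noncommutative symmetric functions\<close>

definition free_algebra :: "'a set \<Rightarrow> ('k::field, 'a list \<Rightarrow>\<^sub>0 'k) module" where
  "free_algebra X = based_algebra (lists X) [] (\<lambda>u v. basis (u @ v))"

text \<open>The number \<open>n \<ge> 1\<close> stands for the generator \<open>S\<^sub>n\<close>.\<close>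

definition Sym :: "('k::field, nat list \<Rightarrow>\<^sub>0 'k) module" where
  "Sym = free_algebra {1..}"


section \<open>Compositions\<close>

definition compositions :: "nat \<Rightarrow> nat list set" where
  "compositions n = {I. 0 \<notin> set I \<and> sum_list I = n}"

definition descent_set :: "nat list \<Rightarrow> nat set" where
  "descent_set I = {sum_list (take k I) | k. 1 \<le> k \<and> k < length I}"

text \<open>
  The operation written \<open>A \<triangleright> B\<close>, for nonempty \<open>A\<close> and \<open>B\<close>; the operation \<open>A \<cdot> B\<close> is \<open>A @ B\<close>.
\<close>

definition near_concat :: "nat list \<Rightarrow> nat list \<Rightarrow> nat list" where
  "near_concat A B = butlast A @ [last A + hd B] @ tl B"

definition coarser :: "nat list \<Rightarrow> nat list \<Rightarrow> bool" where
  "coarser A C \<longleftrightarrow> (\<exists>Cs. [] \<notin> set Cs \<and> concat Cs = C \<and> map sum_list Cs = A)"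

abbreviation finer :: "nat list \<Rightarrow> nat list \<Rightarrow> bool" where
  "finer C A \<equiv> coarser A C"


section \<open>The quotient by the G-composition\<close>

definition GDes :: "nat list \<Rightarrow> nat set" where
  "GDes s = {s ! j | j. Suc j < length s \<and> s ! j > s ! Suc j}"

definition GC :: "nat list \<Rightarrow> nat list" where
  "GC s = (THE I. I \<in> compositions (length s) \<and> descent_set I = (\<lambda>d. d - 1) ` GDes s)"

definition GC_ideal :: "(nat list \<Rightarrow>\<^sub>0 'k::field) set" where
  "GC_ideal = Modules.module.span scale
     {basis s - basis t | s t. s \<in> perms \<and> t \<in> perms \<and> length s = length t \<and> GC s = GC t}"

definition T_alg :: "('k::field, (nat list \<Rightarrow>\<^sub>0 'k) set) module" where
  "T_alg = quot_algebra FQSym GC_ideal"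

text \<open>
  The image of any \<open>F\<^sub>s\<close> with \<open>GC s = I\<close>: by definition of \<open>GC_ideal\<close> it does not depend
  on the choice of \<open>s\<close>, and every composition is the G-composition of some permutation.
\<close>

definition T_basis :: "nat list \<Rightarrow> (nat list \<Rightarrow>\<^sub>0 'k::field) set" where
  "T_basis I = (THE X. \<exists>s\<in>perms. GC s = I \<and> X = GC_ideal +>\<^bsub>FQSym\<^esub> basis s)"

text \<open>
  For a composition \<open>K\<close> and \<open>m \<le> sum_list K\<close> the pair below is unique: the first alternative applies if \<open>K\<close> can be cut
  after a part, i.e. if \<open>m\<close> is a partial sum of \<open>K\<close>, the second one if \<open>m\<close> falls inside a part.
\<close>

definition cut_at :: "nat \<Rightarrow> nat list \<Rightarrow> nat list \<times> nat list" where
  "cut_at m K = (THE (K', K''). K' \<in> compositions m \<and> 0 \<notin> set K'' \<and>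
     (K = K' @ K'' \<or> (K' \<noteq> [] \<and> K'' \<noteq> [] \<and> K = near_concat K' K'')))"

text \<open>
  The case \<open>length K < length I\<close> is separated because then the lower index of the binomial
  coefficient is negative, which subtraction on \<open>nat\<close> does not reflect. If \<open>I\<close> is a composition,
  \<open>length I \<le> sum_list I\<close>, so that the subtraction in the upper index does not truncate.
\<close>

definition T_coeff :: "nat list \<Rightarrow> nat list \<Rightarrow> nat list \<Rightarrow> nat" where
  "T_coeff I J K = (let (K', K'') = cut_at (sum_list I) K in
     if \<not> coarser K' I \<or> \<not> finer K'' J \<or> length K < length I then 0
     else (sum_list I + length J - length I) choose (length K - length I))"

end

theory Submission
  imports Defs
begin

text \<open>
  In a shifted shuffle of \<open>s\<close> and \<open>t\<close> every letter of \<open>s\<close> is smaller than every letter of \<open>t\<close>.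
  Hence a letter of \<open>s\<close> can only stop being a descent (when a letter of \<open>t\<close> is inserted after it),
  and a letter of \<open>t\<close> can only become one (when it is followed by a letter of \<open>s\<close>). Counting the shuffles
  with a prescribed set of Genocchi descents by their first letter, the count splits into two binomial coefficients that
  add up by Pascal's rule; it depends only on the descents of \<open>s\<close> and \<open>t\<close>. So
  the linear map sending \<open>F\<^sub>s\<close> to the basis vector \<open>GC s\<close> carries the product of \<open>FQSym\<close> to the bilinear
  product with structure constants \<open>T_coeff\<close>, and its kernel \<open>GC_ideal\<close> is an ideal.

  For the isomorphism, send \<open>S\<^sub>n\<close> to the class of the identity permutation of size \<open>n\<close>, whose G-composition is
  \<open>(n)\<close>. The product of \<open>T\<^sub>(\<^sub>n\<^sub>)\<close> and \<open>T\<^sub>J\<close> contains \<open>T\<^bsub>n\<cdot>J\<^esub>\<close> with a nonzero coefficient; every other term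
  \<open>T\<^sub>K\<close> has either a first part larger than \<open>n\<close>, or the form \<open>K = n \<cdot> L\<close> with \<open>L\<close> strictly finer than \<open>J\<close>.
  This triangularity shows that the products of the \<open>T\<^sub>(\<^sub>n\<^sub>)\<close> form a basis.
\<close>

section \<open>Genocchi descents of shuffles\<close>

lemma GDes_Nil [simp]: "GDes [] = {}"
  by (simp add: GDes_def)

lemma ex_nat_split: "(\<exists>j. P j) \<longleftrightarrow> P 0 \<or> (\<exists>j. P (Suc j))"
  by (metis not0_implies_Suc)

text \<open>Replaces positions by a recursion along the word, where only the front letter and the
  head of the rest are compared. The inductions on descents use this form.\<close>

lemma GDes_Cons:
  "GDes (a # w) = (if w \<noteq> [] \<and> hd w < a then insert a (GDes w) else GDes w)"
proof -
  have "x \<in> GDes (a # w) \<longleftrightarrow> w \<noteq> [] \<and> hd w < a \<and> x = a \<or> x \<in> GDes w" for x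
  proof -
    have "x \<in> GDes (a # w) \<longleftrightarrow>
        (\<exists>j. Suc j < length (a # w) \<and> (a # w) ! Suc j < (a # w) ! j \<and> x = (a # w) ! j)"
      unfolding GDes_def by blast
    also have "\<dots> \<longleftrightarrow> w \<noteq> [] \<and> w ! 0 < a \<and> x = a \<or> x \<in> GDes w"
      by (subst ex_nat_split) (auto simp: GDes_def)
    finally show ?thesis by (auto simp: hd_conv_nth)
  qed
  then show ?thesis by auto
qed

lemma GDes_subset: "GDes w \<subseteq> set w"
  by (induction w) (auto simp: GDes_Cons)

lemma finite_GDes [simp]: "finite (GDes w)"
  using GDes_subset finite_subset by blast

text \<open>The last letter has no successor and adds no descent. Hence
  \<open>length u - 1 - card (GDes u)\<close> does not truncate for nonempty
  \<open>u\<close>.\<close>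

lemma card_GDes_less: "w \<noteq> [] \<Longrightarrow> card (GDes w) < length w"
proof (induction w)
  case (Cons a w)
  have "card (GDes (a # w)) \<le> Suc (card (GDes w))"
    by (simp add: GDes_Cons card_insert_if)
  with Cons.IH show ?case
    by (cases "w = []") (simp_all add: GDes_Cons)
qed simp

text \<open>With a lower index that may be negative, Pascal's rule holds without a boundary
  case.\<close>

definition binomial_int :: "nat \<Rightarrow> int \<Rightarrow> nat" where
  "binomial_int n k = (if k < 0 then 0 else n choose nat k)"

lemma binomial_int_Suc: "binomial_int (Suc n) k = binomial_int n k + binomial_int n (k - 1)"
proof (cases "k \<le> 0")
  case True
  then show ?thesis by (auto simp: binomial_int_def)
next
  case False
  then obtain j where "nat k = Suc j" by (metis gr0_implies_Suc not_le zero_less_nat_eq)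
  moreover from this have "nat (k - 1) = j" by linarith
  ultimately show ?thesis using False by (simp add: binomial_int_def)
qed

section \<open>Shuffles sorted by the origin of their first letter\<close>

lemma mset_shuffle: "w \<in># shuffle u v \<Longrightarrow> mset w = mset (u @ v)"
  by (induction u v arbitrary: w rule: shuffle.induct) auto

lemma set_shuffle: "w \<in># shuffle u v \<Longrightarrow> set w = set u \<union> set v"
  by (metis mset_shuffle mset_eq_setD set_append)

lemma shuffle_Nil_left [simp]: "shuffle [] v = {#v#}"
  by (cases v) auto

text \<open>Together with \<open>shuffle_right\<close> this separates shuffles by the word that
  supplies the first letter. Whether a letter put in front becomes a descent depends only on that
  first letter.\<close>

definition shuffle_left :: "'a list \<Rightarrow> 'a list \<Rightarrow> 'a list multiset" where
  "shuffle_left u v = (case u of [] \<Rightarrow> {#} | a # u' \<Rightarrow> image_mset ((#) a) (shuffle u' v))"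

definition shuffle_right :: "'a list \<Rightarrow> 'a list \<Rightarrow> 'a list multiset" where
  "shuffle_right u v = (case v of [] \<Rightarrow> {#} | b # v' \<Rightarrow> image_mset ((#) b) (shuffle u v'))"

lemma shuffle_split: "u \<noteq> [] \<Longrightarrow> shuffle u v = shuffle_left u v + shuffle_right u v"
  by (cases u; cases v) (auto simp: shuffle_left_def shuffle_right_def)

lemma in_shuffle_left: "w \<in># shuffle_left u v \<Longrightarrow> set w = set u \<union> set v \<and> w \<noteq> [] \<and> hd w = hd u"
  by (cases u) (auto simp: shuffle_left_def dest: set_shuffle)

lemma in_shuffle_right: "w \<in># shuffle_right u v \<Longrightarrow> set w = set u \<union> set v \<and> w \<noteq> [] \<and> hd w = hd v \<and> v \<noteq> []"
  by (cases v) (auto simp: shuffle_right_def dest: set_shuffle)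

text \<open>
  Comparing with \<open>X \<inter> set w\<close> rather than \<open>X\<close> allows the same target set \<open>X\<close> for all suffixes of a shuffle.
\<close>

definition GDes_count :: "nat list multiset \<Rightarrow> nat set \<Rightarrow> nat" where
  "GDes_count M X = size {#w \<in># M. GDes w = X \<inter> set w#}"

lemma GDes_count_add: "GDes_count (M + N) X = GDes_count M X + GDes_count N X"
  by (simp add: GDes_count_def)

text \<open>\<open>P\<close> is the same for all words of \<open>M\<close> and tells whether
  \<open>a\<close> becomes a descent. So either every extension agrees with \<open>X\<close> at
  \<open>a\<close> or none does; the remaining condition concerns \<open>w\<close> alone, as
  \<open>a\<close> does not occur in it.\<close>

lemma GDes_count_Cons:
  assumes "\<And>w. w \<in># M \<Longrightarrow> a \<notin> set w \<and> (w \<noteq> [] \<and> hd w < a \<longleftrightarrow> P)"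
  shows "GDes_count (image_mset ((#) a) M) X = (if a \<in> X \<longleftrightarrow> P then GDes_count M X else 0)"
proof -
  have "GDes (a # w) = X \<inter> set (a # w) \<longleftrightarrow> (a \<in> X \<longleftrightarrow> P) \<and> GDes w = X \<inter> set w" if "w \<in># M" for w
    using assms[OF that] GDes_subset[of w] by (auto simp: GDes_Cons)
  then have "GDes_count (image_mset ((#) a) M) X = size {#w \<in># M. (a \<in> X \<longleftrightarrow> P) \<and> GDes w = X \<inter> set w#}"
    unfolding GDes_count_def filter_mset_image_mset o_def size_image_mset
    by (intro arg_cong[where f = size] filter_mset_cong) auto
  then show ?thesis by (auto simp: GDes_count_def)
qed

text \<open>Start of the induction: the only shuffle beginning with \<open>a\<close> puts it before
  all of \<open>v\<close>, where it is no descent.\<close>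

lemma GDes_count_left_singleton:
  assumes "\<And>y. y \<in> set v \<Longrightarrow> a < y"
  shows "GDes_count (shuffle_left [a] v) X = (if a \<notin> X \<and> GDes v = X \<inter> set v then 1 else 0)"
proof -
  have "GDes_count (image_mset ((#) a) {#v#}) X = (if a \<in> X \<longleftrightarrow> False then GDes_count {#v#} X else 0)"
    by (rule GDes_count_Cons) (use assms in \<open>auto dest: order.asym[OF assms[OF hd_in_set]]\<close>)
  then show ?thesis by (auto simp: shuffle_left_def GDes_count_def)
qed

text \<open>The letter after \<open>a\<close> is either \<open>hd u\<close>, as in
  \<open>a # u\<close> itself, or the head of \<open>v\<close>, which is larger and prevents a
  descent at \<open>a\<close>.\<close>

lemma GDes_count_left_Cons:
  assumes "u \<noteq> []" "a \<notin> set u" "\<And>y. y \<in> set v \<Longrightarrow> a < y"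
  shows "GDes_count (shuffle_left (a # u) v) X =
    (if a \<in> X \<longleftrightarrow> hd u < a then GDes_count (shuffle_left u v) X else 0) +
    (if a \<in> X then 0 else GDes_count (shuffle_right u v) X)"
proof -
  have "GDes_count (image_mset ((#) a) (shuffle_left u v)) X =
      (if a \<in> X \<longleftrightarrow> hd u < a then GDes_count (shuffle_left u v) X else 0)"
    by (rule GDes_count_Cons) (use assms in \<open>auto dest!: in_shuffle_left\<close>)
  moreover have "GDes_count (image_mset ((#) a) (shuffle_right u v)) X =
      (if a \<in> X \<longleftrightarrow> False then GDes_count (shuffle_right u v) X else 0)"
    by (rule GDes_count_Cons)
      (use assms in \<open>auto dest!: in_shuffle_right dest: order.asym[OF assms(3)[OF hd_in_set]]\<close>)
  ultimately show ?thesis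
    using assms(1) by (auto simp: shuffle_left_def[of "a # u"] shuffle_split GDes_count_add)
qed

text \<open>The letter after \<open>b\<close> either comes from \<open>u\<close> and is smaller,
  which makes \<open>b\<close> a descent, or comes from \<open>v\<close>, which leaves
  \<open>b\<close> as it is in \<open>b # v\<close>.\<close>

lemma GDes_count_right_Cons:
  assumes "u \<noteq> []" "b \<notin> set v" "\<And>x. x \<in> set u \<Longrightarrow> x < b"
  shows "GDes_count (shuffle_right u (b # v)) X =
    (if b \<in> X then GDes_count (shuffle_left u v) X else 0) +
    (if b \<in> X \<longleftrightarrow> v \<noteq> [] \<and> hd v < b then GDes_count (shuffle_right u v) X else 0)"
proof -
  have "GDes_count (image_mset ((#) b) (shuffle_left u v)) X =
      (if b \<in> X \<longleftrightarrow> True then GDes_count (shuffle_left u v) X else 0)"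
    by (rule GDes_count_Cons) (use assms in \<open>auto dest!: in_shuffle_left\<close>)
  moreover have "GDes_count (image_mset ((#) b) (shuffle_right u v)) X =
      (if b \<in> X \<longleftrightarrow> v \<noteq> [] \<and> hd v < b then GDes_count (shuffle_right u v) X else 0)"
    by (rule GDes_count_Cons) (use assms in \<open>auto dest!: in_shuffle_right\<close>)
  ultimately show ?thesis
    using assms(1) by (auto simp: shuffle_right_def[of u "b # v"] shuffle_split GDes_count_add)
qed

text \<open>
  Both identities are proved simultaneously by removing the first letter. If the first letter of \<open>u\<close> is no
  descent of \<open>u\<close>, or the first letter of \<open>v\<close> is a descent of \<open>v\<close>, the two counts for the remaining words add up
  by Pascal's rule; otherwise membership in \<open>X\<close> selects one of them.
\<close>

lemma GDes_count_left_right: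
  fixes u v :: "nat list" and X :: "nat set"
  assumes "u \<noteq> []" "distinct u" "distinct v" "\<And>x y. x \<in> set u \<Longrightarrow> y \<in> set v \<Longrightarrow> x < y"
  defines "n \<equiv> length u - 1 - card (GDes u) + card (GDes v)"
    and "k \<equiv> int (card (X \<inter> set u)) + int (card (X \<inter> set v)) - int (card (GDes u))"
    and "C \<equiv> X \<inter> set u \<subseteq> GDes u \<and> GDes v \<subseteq> X"
  shows "GDes_count (shuffle_left u v) X = (if C then binomial_int n k else 0) \<and>
    GDes_count (shuffle_right u v) X = (if C then binomial_int n (k - 1) else 0)"
  using assms(1-4) unfolding n_def k_def C_def
proof (induction "length u + length v" arbitrary: u v rule: less_induct)
  case less
  note prems = less.prems
  have fin: "finite (X \<inter> set w)" for w by simp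
  have left: "GDes_count (shuffle_left u v) X =
    (if X \<inter> set u \<subseteq> GDes u \<and> GDes v \<subseteq> X then
      binomial_int (length u - 1 - card (GDes u) + card (GDes v))
        (int (card (X \<inter> set u)) + int (card (X \<inter> set v)) - int (card (GDes u))) else 0)"
  proof -
    obtain a u' where u: "u = a # u'" using prems(1) by (cases u) auto
    show ?thesis
    proof (cases "u' = []")
      case True
      \<comment> \<open>\<open>GDes v\<close> lies in the finite set
        \<open>X \<inter> set v\<close>, so cardinalities decide equality. The lower index is at
        least the upper one, and the binomial coefficient is 1 or 0.\<close>
      have *: "GDes v = X \<inter> set v \<longleftrightarrow> card (X \<inter> set v) \<le> card (GDes v)" if "GDes v \<subseteq> X"
        using that GDes_subset[of v] by (metis fin card_seteq le_inf_iff order_refl)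
      have "binomial_int (card (GDes v)) (int (card (X \<inter> set v))) = (if GDes v = X \<inter> set v then 1 else 0)"
        if "GDes v \<subseteq> X"
        using *[OF that] by (auto simp: binomial_int_def)
      then show ?thesis
        using prems(4) GDes_count_left_singleton[of v a X] unfolding u True
        by (auto simp: GDes_Cons)
    next
      case False
      have IH: "GDes_count (shuffle_left u' v) X = (if X \<inter> set u' \<subseteq> GDes u' \<and> GDes v \<subseteq> X
           then binomial_int (length u' - 1 - card (GDes u') + card (GDes v))
              (int (card (X \<inter> set u')) + int (card (X \<inter> set v)) - int (card (GDes u'))) else 0)"
        "GDes_count (shuffle_right u' v) X = (if X \<inter> set u' \<subseteq> GDes u' \<and> GDes v \<subseteq> X
           then binomial_int (length u' - 1 - card (GDes u') + card (GDes v))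
              (int (card (X \<inter> set u')) + int (card (X \<inter> set v)) - int (card (GDes u')) - 1) else 0)"
        using less.hyps[of u' v] False prems unfolding u by auto
      have a: "a \<notin> set u'" "a \<notin> GDes u'" using prems(2) GDes_subset unfolding u by auto
      have ins: "card (X \<inter> insert a (set u')) = (if a \<in> X then 1 else 0) + card (X \<inter> set u')"
        using a by (auto simp: card_insert_if)
      \<comment> \<open>\<open>r\<close> counts the letters of \<open>u'\<close> that are no
        descents, apart from the last one; writing the length as a sum removes the natural
        subtraction.\<close>
      obtain r where r: "length u' = Suc (card (GDes u') + r)"
        using card_GDes_less[OF False] less_iff_Suc_add by auto
      have rec: "GDes_count (shuffle_left u v) X =
          (if a \<in> X \<longleftrightarrow> hd u' < a then GDes_count (shuffle_left u' v) X else 0) +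
          (if a \<in> X then 0 else GDes_count (shuffle_right u' v) X)"
        unfolding u by (rule GDes_count_left_Cons) (use False prems in \<open>auto simp: u\<close>)
      have C: "X \<inter> set u \<subseteq> GDes u \<longleftrightarrow> (a \<in> X \<longrightarrow> hd u' < a) \<and> X \<inter> set u' \<subseteq> GDes u'"
        using a False by (auto simp: u GDes_Cons)
      show ?thesis
        unfolding rec IH C using a False
        by (auto simp: u ins r GDes_Cons binomial_int_Suc algebra_simps)
    qed
  qed
  have right: "GDes_count (shuffle_right u v) X =
    (if X \<inter> set u \<subseteq> GDes u \<and> GDes v \<subseteq> X then
      binomial_int (length u - 1 - card (GDes u) + card (GDes v))
        (int (card (X \<inter> set u)) + int (card (X \<inter> set v)) - int (card (GDes u)) - 1) else 0)"
  proof (cases v)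
    case Nil
    \<comment> \<open>No shuffle starts in the empty word \<open>v\<close>; accordingly the lower
      index is negative.\<close>
    have "card (X \<inter> set u) \<le> card (GDes u)" if "X \<inter> set u \<subseteq> GDes u"
      using that by (simp add: card_mono)
    then show ?thesis
      unfolding Nil by (auto simp: shuffle_right_def GDes_count_def binomial_int_def)
  next
    case (Cons b v')
    have IH: "GDes_count (shuffle_left u v') X = (if X \<inter> set u \<subseteq> GDes u \<and> GDes v' \<subseteq> X
         then binomial_int (length u - 1 - card (GDes u) + card (GDes v'))
            (int (card (X \<inter> set u)) + int (card (X \<inter> set v')) - int (card (GDes u))) else 0)"
      "GDes_count (shuffle_right u v') X = (if X \<inter> set u \<subseteq> GDes u \<and> GDes v' \<subseteq> X
         then binomial_int (length u - 1 - card (GDes u) + card (GDes v'))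
            (int (card (X \<inter> set u)) + int (card (X \<inter> set v')) - int (card (GDes u)) - 1) else 0)"
      using less.hyps[of u v'] prems unfolding Cons by auto
    have b: "b \<notin> set v'" "b \<notin> GDes v'" using prems(3) GDes_subset unfolding Cons by auto
    have ins: "card (X \<inter> insert b (set v')) = (if b \<in> X then 1 else 0) + card (X \<inter> set v')"
      using b by (auto simp: card_insert_if)
    have rec: "GDes_count (shuffle_right u v) X =
        (if b \<in> X then GDes_count (shuffle_left u v') X else 0) +
        (if b \<in> X \<longleftrightarrow> v' \<noteq> [] \<and> hd v' < b then GDes_count (shuffle_right u v') X else 0)"
      unfolding Cons by (rule GDes_count_right_Cons) (use prems in \<open>auto simp: Cons\<close>)
    show ?thesis
    proof (cases "v' \<noteq> [] \<and> hd v' < b")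
      case True
      then show ?thesis
        unfolding rec IH using b
        by (auto simp: Cons ins GDes_Cons binomial_int_Suc algebra_simps)
    next
      case False
      then show ?thesis
        unfolding rec IH using b
        by (auto simp: Cons ins GDes_Cons algebra_simps)
    qed
  qed
  from left right show ?case by blast
qed

text \<open>The two kinds of first letter contribute lower indices \<open>k\<close> and
  \<open>k - 1\<close>, which Pascal's rule merges. The words enter only through their letters,
  their descents and the length of \<open>u\<close>; this makes the product compatible with
  \<open>GC\<close>.\<close>

lemma GDes_count_shuffle:
  fixes u v :: "nat list"
  assumes "u \<noteq> []" "distinct u" "distinct v" "\<And>x y. x \<in> set u \<Longrightarrow> y \<in> set v \<Longrightarrow> x < y"
  shows "GDes_count (shuffle u v) X =
    (if X \<inter> set u \<subseteq> GDes u \<and> GDes v \<subseteq> X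
     then binomial_int (length u + card (GDes v) - card (GDes u))
       (int (card (X \<inter> set u)) + int (card (X \<inter> set v)) - int (card (GDes u))) else 0)"
proof -
  have "length u + card (GDes v) - card (GDes u) = Suc (length u - 1 - card (GDes u) + card (GDes v))"
    using card_GDes_less[OF assms(1)] by simp
  then show ?thesis
    using GDes_count_left_right[OF assms, of X]
    by (simp add: shuffle_split[OF assms(1)] GDes_count_add binomial_int_Suc)
qed

section \<open>Compositions and descent sets\<close>

lemma descent_set_Nil [simp]: "descent_set [] = {}"
  by (simp add: descent_set_def)

lemma descent_set_Cons:
  "descent_set (a # A) = (if A = [] then {} else insert a ((+) a ` descent_set A))"
proof -
  have "x \<in> descent_set (a # A) \<longleftrightarrow> A \<noteq> [] \<and> (x = a \<or> x \<in> (+) a ` descent_set A)" for x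
  proof -
    have "x \<in> descent_set (a # A) \<longleftrightarrow>
        (\<exists>k. 1 \<le> k \<and> k < Suc (length A) \<and> x = sum_list (take k (a # A)))"
      by (auto simp: descent_set_def)
    also have "\<dots> \<longleftrightarrow> (\<exists>k. k < length A \<and> x = a + sum_list (take k A))"
      by (subst ex_nat_split) auto
    also have "\<dots> \<longleftrightarrow> A \<noteq> [] \<and> (x = a \<or> (\<exists>k. Suc k < length A \<and> x = a + sum_list (take (Suc k) A)))"
      by (subst ex_nat_split) auto
    also have "(\<exists>k. Suc k < length A \<and> x = a + sum_list (take (Suc k) A)) \<longleftrightarrow> x \<in> (+) a ` descent_set A"
      unfolding descent_set_def image_def
      by (auto simp: Suc_le_eq gr0_conv_Suc)
    finally show ?thesis .
  qed
  then show ?thesis by auto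
qed

lemma compositions_Nil_iff [simp]: "[] \<in> compositions n \<longleftrightarrow> n = 0"
  by (auto simp: compositions_def)

lemma compositions_Cons_iff:
  "a # A \<in> compositions n \<longleftrightarrow> 0 < a \<and> a \<le> n \<and> A \<in> compositions (n - a)"
  by (auto simp: compositions_def)

lemma compositions_0 [simp]: "compositions 0 = {[]}"
proof -
  have "I \<in> compositions 0 \<longleftrightarrow> I = []" for I
    by (cases I) (auto simp: compositions_Cons_iff)
  then show ?thesis by auto
qed

lemma sum_list_composition: "I \<in> compositions n \<Longrightarrow> sum_list I = n"
  by (simp add: compositions_def)

lemma composition_Nil_iff: "A \<in> compositions n \<Longrightarrow> A = [] \<longleftrightarrow> n = 0"
  by (cases A) (auto simp: compositions_Cons_iff)

lemma length_composition_le: "A \<in> compositions n \<Longrightarrow> length A \<le> n"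
  by (induction A arbitrary: n) (force simp: compositions_Cons_iff)+

lemma finite_compositions [simp]: "finite (compositions n)"
proof (rule finite_subset)
  show "compositions n \<subseteq> {A. set A \<subseteq> {..n} \<and> length A \<le> n}"
    using length_composition_le by (auto simp: compositions_def dest: member_le_sum_list)
  show "finite {A. set A \<subseteq> {..n} \<and> length A \<le> n}"
    by (rule finite_lists_length_le) simp
qed

lemma descent_set_bounds: "A \<in> compositions n \<Longrightarrow> descent_set A \<subseteq> {1..<n}"
proof (induction A arbitrary: n)
  case (Cons a A)
  then have "descent_set A \<subseteq> {1..<n - a}" "0 < a" "a \<le> n" "A = [] \<longleftrightarrow> n - a = 0"
    by (auto simp: compositions_Cons_iff composition_Nil_iff)
  then show ?case by (fastforce simp: descent_set_Cons)
qed simp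

lemma finite_descent_set [simp]: "finite (descent_set A)"
  by (induction A) (auto simp: descent_set_Cons)

lemma card_descent_set: "A \<in> compositions n \<Longrightarrow> card (descent_set A) = length A - 1"
proof (induction A arbitrary: n)
  case (Cons a A)
  then have A: "A \<in> compositions (n - a)" by (simp add: compositions_Cons_iff)
  then have "a \<notin> (+) a ` descent_set A" using descent_set_bounds by fastforce
  then show ?case
    using Cons.IH[OF A] by (cases A) (auto simp: descent_set_Cons[of a] card_image)
qed simp

text \<open>If there is more than one part, the first part is the least element of the descent set,
  and the other elements, shifted back, form the descent set of the rest.\<close>

lemma descent_set_inject:
  assumes "A \<in> compositions n" "B \<in> compositions n" "descent_set A = descent_set B"
  shows "A = B"
  using assms
proof (induction A arbitrary: B n)
  case Nil
  then show ?case by (simp add: composition_Nil_iff)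
next
  case (Cons a A)
  then obtain b B' where B: "B = b # B'"
    by (cases B) (auto simp: composition_Nil_iff compositions_Cons_iff)
  have AB: "A \<in> compositions (n - a)" "B' \<in> compositions (n - b)" "0 < a" "a \<le> n" "0 < b" "b \<le> n"
    using Cons.prems by (auto simp: B compositions_Cons_iff)
  have low: "\<forall>x\<in>descent_set A. 0 < x" "\<forall>x\<in>descent_set B'. 0 < x"
    using descent_set_bounds[OF AB(1)] descent_set_bounds[OF AB(2)] by force+
  show ?case
  proof (cases "A = [] \<or> B' = []")
    case True
    then show ?thesis
      using Cons.prems(3) AB unfolding B descent_set_Cons
      by (auto simp: composition_Nil_iff split: if_splits)
  next
    case False
    have eq: "insert a ((+) a ` descent_set A) = insert b ((+) b ` descent_set B')"
      using Cons.prems(3) False by (simp add: B descent_set_Cons)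
    have "a \<in> insert b ((+) b ` descent_set B')" "b \<in> insert a ((+) a ` descent_set A)"
      using eq by blast+
    then have "a = b" using low by auto
    moreover have "a \<notin> (+) a ` descent_set A" "a \<notin> (+) a ` descent_set B'"
      using low by auto
    ultimately have "(+) a ` descent_set A = (+) a ` descent_set B'"
      using eq by (simp add: insert_ident)
    then have "descent_set A = descent_set B'"
      by (simp add: inj_image_eq_iff)
    then show ?thesis
      using Cons.IH AB \<open>a = b\<close> by (simp add: B)
  qed
qed

text \<open>With \<open>descent_set_inject\<close>, compositions of \<open>n\<close> correspond to
  subsets of \<open>{1..<n}\<close>. The minimum of a nonempty \<open>S\<close> is the first part;
  the rest of \<open>S\<close>, shifted back, gives the other parts.\<close>

lemma ex_composition_descent_set:
  assumes "S \<subseteq> {1..<n}"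
  shows "\<exists>A\<in>compositions n. descent_set A = S"
  using assms
proof (induction n arbitrary: S rule: less_induct)
  case (less n)
  consider "n = 0" | "n > 0" "S = {}" | "S \<noteq> {}" by blast
  then show ?case
  proof cases
    case 1
    then show ?thesis using less.prems by simp
  next
    case 2
    then have "[n] \<in> compositions n" "descent_set [n] = S"
      by (auto simp: compositions_Cons_iff descent_set_Cons)
    then show ?thesis by blast
  next
    case 3
    have "finite S" using less.prems finite_subset by blast
    define a where "a = Min S"
    have a: "a \<in> S" "\<And>x. x \<in> S \<Longrightarrow> a \<le> x"
      using 3 \<open>finite S\<close> by (auto simp: a_def)
    define S' where "S' = (\<lambda>x. x - a) ` (S - {a})"
    have S: "S = insert a ((+) a ` S')"
      using a by (auto simp: S'_def image_image)
    have "S' \<subseteq> {1..<n - a}"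
      using less.prems a by (force simp: S'_def)
    moreover have "n - a < n" "0 < a" "a < n" using a(1) less.prems by auto
    ultimately obtain A where A: "A \<in> compositions (n - a)" "descent_set A = S'"
      using less.IH by blast
    have "a # A \<in> compositions n" "A \<noteq> []"
      using A \<open>0 < a\<close> \<open>a < n\<close> by (auto simp: compositions_Cons_iff)
    moreover have "descent_set (a # A) = S"
      using \<open>A \<noteq> []\<close> A(2) S by (simp add: descent_set_Cons)
    ultimately show ?thesis by blast
  qed
qed

section \<open>Descent sets of the two concatenations\<close>

lemma descent_set_append:
  "A \<noteq> [] \<Longrightarrow> B \<noteq> [] \<Longrightarrow>
    descent_set (A @ B) = descent_set A \<union> {sum_list A} \<union> (+) (sum_list A) ` descent_set B"
proof (induction A)
  case (Cons a A)
  then show ?case by (cases "A = []") (auto simp: descent_set_Cons image_Un image_image add.assoc)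
qed simp

lemma near_concat_single: "near_concat [a] (b # B) = (a + b) # B"
  by (simp add: near_concat_def)

lemma near_concat_Cons: "A \<noteq> [] \<Longrightarrow> near_concat (a # A) B = a # near_concat A B"
  by (simp add: near_concat_def)

lemma near_concat_not_Nil [simp]: "near_concat A B \<noteq> []"
  by (simp add: near_concat_def)

text \<open>Merging the two adjacent parts drops the point \<open>sum_list A\<close> that
  \<open>descent_set_append\<close> contributes.\<close>

lemma descent_set_near_concat:
  "A \<noteq> [] \<Longrightarrow> B \<noteq> [] \<Longrightarrow>
    descent_set (near_concat A B) = descent_set A \<union> (+) (sum_list A) ` descent_set B"
proof (induction A)
  case (Cons a A)
  show ?case
  proof (cases "A = []")
    case True
    with Cons.prems show ?thesis
      by (cases B) (auto simp: near_concat_single descent_set_Cons image_image add.assoc)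
  next
    case False
    with Cons show ?thesis
      by (auto simp: near_concat_Cons descent_set_Cons[of a] image_Un image_image add.assoc)
  qed
qed simp

lemma near_concat_in_compositions:
  "A \<in> compositions m \<Longrightarrow> B \<in> compositions n \<Longrightarrow> A \<noteq> [] \<Longrightarrow> B \<noteq> [] \<Longrightarrow>
    near_concat A B \<in> compositions (m + n)"
proof (induction A arbitrary: m)
  case (Cons a A)
  show ?case
  proof (cases "A = []")
    case True
    with Cons.prems show ?thesis
      by (cases B) (auto simp: near_concat_single compositions_Cons_iff)
  next
    case False
    with Cons.prems Cons.IH[of "m - a"] show ?thesis
      by (auto simp: near_concat_Cons compositions_Cons_iff)
  qed
qed simp

lemma append_in_compositions:
  "A \<in> compositions m \<Longrightarrow> B \<in> compositions n \<Longrightarrow> A @ B \<in> compositions (m + n)"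
  by (auto simp: compositions_def)

section \<open>Coarsening as inclusion of descent sets\<close>

text \<open>Partial sums of the block sums are the partial sums of the concatenation taken at block
  ends.\<close>

lemma coarser_imp_descent_set_subset:
  "[] \<notin> set Cs \<Longrightarrow> descent_set (map sum_list Cs) \<subseteq> descent_set (concat Cs)"
proof (induction Cs)
  case (Cons c Cs)
  show ?case
  proof (cases "Cs = []")
    case False
    then have "c \<noteq> []" "concat Cs \<noteq> []" using Cons.prems by (cases Cs; auto)+
    then show ?thesis
      using Cons by (auto simp: descent_set_append descent_set_Cons)
  qed (simp add: descent_set_Cons)
qed simp

text \<open>Unless \<open>A\<close> has a single part, its first part is a partial sum of
  \<open>C\<close>, so \<open>C\<close> can be cut there. The piece before the cut is the first
  block, and the inclusion passes to the rest.\<close>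

lemma descent_set_subset_imp_coarser:
  "A \<in> compositions n \<Longrightarrow> C \<in> compositions n \<Longrightarrow> descent_set A \<subseteq> descent_set C \<Longrightarrow> coarser A C"
proof (induction A arbitrary: n C)
  case Nil
  then show ?case by (auto simp: composition_Nil_iff coarser_def intro: exI[of _ "[]"])
next
  case (Cons a A)
  show ?case
  proof (cases "A = []")
    case True
    then have "sum_list C = a" "C \<noteq> []"
      using Cons.prems by (auto simp: compositions_Cons_iff sum_list_composition)
    then show ?thesis unfolding True coarser_def by (intro exI[of _ "[C]"]) auto
  next
    case False
    then have "a \<in> descent_set C" using Cons.prems(3) by (simp add: descent_set_Cons)
    then obtain k where k: "a = sum_list (take k C)" "1 \<le> k" "k < length C"
      by (auto simp: descent_set_def)
    define P Q where "P = take k C" and "Q = drop k C"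
    have PQ: "C = P @ Q" "sum_list P = a" "P \<noteq> []" "Q \<noteq> []" using k by (auto simp: P_def Q_def)
    have A: "A \<in> compositions (n - a)" using Cons.prems by (simp add: compositions_Cons_iff)
    have Q: "Q \<in> compositions (n - a)" and P: "P \<in> compositions a"
      using Cons.prems(2) PQ by (auto simp: compositions_def)
    have "descent_set A \<subseteq> descent_set Q"
    proof
      fix x assume x: "x \<in> descent_set A"
      then have "a + x \<in> descent_set P \<union> {a} \<union> (+) a ` descent_set Q"
        using Cons.prems(3) False PQ by (auto simp: descent_set_append descent_set_Cons)
      \<comment> \<open>\<open>a + x\<close> lies beyond all descents of \<open>P\<close> and
        differs from \<open>a\<close>, so it must come from \<open>Q\<close>.\<close>
      moreover have "a + x \<notin> descent_set P" "x \<noteq> 0"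
        using descent_set_bounds[OF P] descent_set_bounds[OF A] x by auto
      ultimately show "x \<in> descent_set Q" by auto
    qed
    then obtain Cs where "[] \<notin> set Cs" "concat Cs = Q" "map sum_list Cs = A"
      using Cons.IH[OF A Q] by (auto simp: coarser_def)
    then show ?thesis
      using PQ unfolding coarser_def by (intro exI[of _ "P # Cs"]) auto
  qed
qed

lemma coarser_iff_descent_set:
  "A \<in> compositions n \<Longrightarrow> C \<in> compositions n \<Longrightarrow> coarser A C \<longleftrightarrow> descent_set A \<subseteq> descent_set C"
  using coarser_imp_descent_set_subset descent_set_subset_imp_coarser
  by (auto simp: coarser_def)

section \<open>Cutting a composition at a given size\<close>

text \<open>Descents of \<open>K\<close> below \<open>m\<close> belong to \<open>A\<close>, those
  above \<open>m\<close>, shifted back, to \<open>B\<close>; so \<open>K\<close> and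
  \<open>m\<close> determine both pieces. The point \<open>m\<close> itself only decides between the
  two ways of joining.\<close>

lemma cut_at_unique:
  assumes K: "K \<in> compositions (m + n)"
    and A: "A \<in> compositions m" "0 \<notin> set B" "K = A @ B \<or> A \<noteq> [] \<and> B \<noteq> [] \<and> K = near_concat A B"
  shows "B \<in> compositions n \<and> descent_set A = descent_set K \<inter> {1..<m} \<and>
    descent_set B = {d. 0 < d \<and> m + d \<in> descent_set K}"
proof -
  obtain k where Bk: "B \<in> compositions k" using A(2) by (auto simp: compositions_def)
  then have "K \<in> compositions (m + k)"
    using A append_in_compositions near_concat_in_compositions by blast
  then have B: "B \<in> compositions n"
    using K Bk by (auto simp: compositions_def)
  have bounds: "\<And>x. x \<in> descent_set A \<Longrightarrow> 0 < x \<and> x < m" "\<And>x. x \<in> descent_set B \<Longrightarrow> 0 < x"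
    using descent_set_bounds[OF A(1)] descent_set_bounds[OF B] by force+
  have sumA: "sum_list A = m" using A(1) by (rule sum_list_composition)
  consider "A = []" "K = B" | "B = []" "K = A"
    | "A \<noteq> []" "B \<noteq> []" "K = A @ B" | "A \<noteq> []" "B \<noteq> []" "K = near_concat A B"
    using A(3) by (cases "A = []"; cases "B = []") auto
  then have "descent_set A = descent_set K \<inter> {1..<m} \<and> descent_set B = {d. 0 < d \<and> m + d \<in> descent_set K}"
  proof cases
    case 1
    then have "m = 0" using A(1) by simp
    then show ?thesis using 1 bounds by auto
  next
    case 2
    then show ?thesis using bounds by fastforce
  next
    case 3
    then show ?thesis using bounds by (fastforce simp: descent_set_append sumA)
  next
    case 4
    then show ?thesis using bounds by (fastforce simp: descent_set_near_concat sumA)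
  qed
  with B show ?thesis by blast
qed

lemma ex_cut:
  assumes K: "K \<in> compositions (m + n)"
  shows "\<exists>A B. A \<in> compositions m \<and> 0 \<notin> set B \<and> (K = A @ B \<or> A \<noteq> [] \<and> B \<noteq> [] \<and> K = near_concat A B)"
\<comment> \<open>If one piece is empty, the other is \<open>K\<close>, and only plain concatenation
  is available.\<close>
proof (cases "m = 0 \<or> n = 0")
  case True
  then consider "m = 0" | "n = 0" by blast
  then show ?thesis
  proof cases
    case 1
    then show ?thesis using K by (intro exI[of _ "[]"] exI[of _ K]) (auto simp: compositions_def)
  next
    case 2
    then show ?thesis using K by (intro exI[of _ K] exI[of _ "[]"]) (auto simp: compositions_def)
  qed
next
  case False
  have bounds: "descent_set K \<subseteq> {1..<m + n}" using descent_set_bounds[OF K] .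
  obtain A where A: "A \<in> compositions m" "descent_set A = descent_set K \<inter> {1..<m}"
    using ex_composition_descent_set[of "descent_set K \<inter> {1..<m}" m] by auto
  have "{d. 0 < d \<and> m + d \<in> descent_set K} \<subseteq> {1..<n}" using bounds by auto
  then obtain B where B: "B \<in> compositions n" "descent_set B = {d. 0 < d \<and> m + d \<in> descent_set K}"
    using ex_composition_descent_set by metis
  have ne: "A \<noteq> []" "B \<noteq> []" using A B False by (auto simp: composition_Nil_iff)
  have sumA: "sum_list A = m" using A(1) by (rule sum_list_composition)
  have split: "x \<in> descent_set K \<longleftrightarrow>
    x \<in> descent_set A \<or> x = m \<and> m \<in> descent_set K \<or> x \<in> (+) m ` descent_set B" for x
  proof -
    consider "x < m" | "x = m" | d where "x = m + d" "0 < d"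
      by (metis less_imp_add_positive linorder_neqE_nat)
    then show ?thesis
      using bounds A(2) B(2) by cases force+
  qed
  \<comment> \<open>The pieces reproduce all descents of \<open>K\<close> other than
    \<open>m\<close>; choosing the right kind of joining settles \<open>m\<close>.\<close>
  have "K = (if m \<in> descent_set K then A @ B else near_concat A B)"
  proof (rule descent_set_inject[OF K])
    show "(if m \<in> descent_set K then A @ B else near_concat A B) \<in> compositions (m + n)"
      using A B ne by (simp add: append_in_compositions near_concat_in_compositions)
    show "descent_set K = descent_set (if m \<in> descent_set K then A @ B else near_concat A B)"
    proof (rule Set.set_eqI)
      fix x
      show "x \<in> descent_set K \<longleftrightarrow> x \<in> descent_set (if m \<in> descent_set K then A @ B else near_concat A B)"
        using split[of x]
        by (cases "m \<in> descent_set K")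
          (simp_all add: descent_set_append descent_set_near_concat sumA ne disj_left_commute)
    qed
  qed
  then show ?thesis
    using A B ne by (intro exI[of _ A] exI[of _ B]) (auto simp: compositions_def split: if_splits)
qed

lemma cut_at_eqI:
  assumes K: "K \<in> compositions (m + n)"
    and A: "A \<in> compositions m" "0 \<notin> set B" "K = A @ B \<or> A \<noteq> [] \<and> B \<noteq> [] \<and> K = near_concat A B"
  shows "cut_at m K = (A, B)"
  unfolding cut_at_def
proof (rule the_equality)
  show "case (A, B) of (K', K'') \<Rightarrow> K' \<in> compositions m \<and> 0 \<notin> set K'' \<and>
      (K = K' @ K'' \<or> K' \<noteq> [] \<and> K'' \<noteq> [] \<and> K = near_concat K' K'')"
    using A by simp
next
  fix p
  assume *: "case p of (K', K'') \<Rightarrow> K' \<in> compositions m \<and> 0 \<notin> set K'' \<and>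
      (K = K' @ K'' \<or> K' \<noteq> [] \<and> K'' \<noteq> [] \<and> K = near_concat K' K'')"
  show "p = (A, B)"
  proof (cases p)
    case (Pair A' B')
    have A': "A' \<in> compositions m" "0 \<notin> set B'"
        "K = A' @ B' \<or> A' \<noteq> [] \<and> B' \<noteq> [] \<and> K = near_concat A' B'"
      using * unfolding Pair prod.case by blast+
    note AB = cut_at_unique[OF K A] and AB' = cut_at_unique[OF K A']
    have "A' = A" by (rule descent_set_inject[OF A'(1) A(1)]) (simp add: AB AB')
    moreover have "B' = B" by (rule descent_set_inject[of _ n]) (simp_all add: AB AB')
    ultimately show ?thesis by (simp add: Pair)
  qed
qed

lemma cut_at_cases:
  assumes K: "K \<in> compositions (m + n)"
  obtains A B where "cut_at m K = (A, B)" "A \<in> compositions m" "B \<in> compositions n"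
    "K = A @ B \<or> A \<noteq> [] \<and> B \<noteq> [] \<and> K = near_concat A B"
    "descent_set A = descent_set K \<inter> {1..<m}"
    "descent_set B = {d. 0 < d \<and> m + d \<in> descent_set K}"
proof -
  obtain A B where AB: "A \<in> compositions m" "0 \<notin> set B"
      "K = A @ B \<or> A \<noteq> [] \<and> B \<noteq> [] \<and> K = near_concat A B"
    using ex_cut[OF K] by blast
  then show ?thesis
    using that cut_at_eqI[OF K AB] cut_at_unique[OF K AB] by blast
qed

text \<open>Turns coarseness of the two pieces into inclusions of descent sets, the form that the
  shuffle count has. The negative lower index of \<open>binomial_int\<close> covers the case
  \<open>length K < length I\<close>.\<close>

lemma T_coeff_compositions:
  assumes I: "I \<in> compositions m" and J: "J \<in> compositions n" and K: "K \<in> compositions (m + n)"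
  shows "T_coeff I J K =
    (if descent_set K \<inter> {1..<m} \<subseteq> descent_set I \<and> (+) m ` descent_set J \<subseteq> descent_set K
     then binomial_int (m + length J - length I) (int (length K) - int (length I)) else 0)"
proof -
  obtain A B where AB: "cut_at m K = (A, B)" "A \<in> compositions m" "B \<in> compositions n"
    "descent_set A = descent_set K \<inter> {1..<m}"
    "descent_set B = {d. 0 < d \<and> m + d \<in> descent_set K}"
    by (rule cut_at_cases[OF K])
  have "descent_set J \<subseteq> descent_set B \<longleftrightarrow> (+) m ` descent_set J \<subseteq> descent_set K"
    using descent_set_bounds[OF J] unfolding AB(5) by force
  moreover have "coarser A I \<longleftrightarrow> descent_set A \<subseteq> descent_set I" "coarser J B \<longleftrightarrow> descent_set J \<subseteq> descent_set B"
    using coarser_iff_descent_set I J AB by blast+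
  ultimately show ?thesis
    unfolding T_coeff_def sum_list_composition[OF I] AB(1) Let_def prod.case
    by (auto simp: AB(4) binomial_int_def nat_diff_distrib')
qed

section \<open>G-compositions of shifted shuffles\<close>

lemma perms_iff: "s \<in> perms \<longleftrightarrow> distinct s \<and> set s = {1..length s}"
proof
  assume "s \<in> perms"
  then obtain n where "distinct s" "set s = {1..n}"
    by (auto simp: perms_def permutations_of_set_def)
  then show "distinct s \<and> set s = {1..length s}"
    using distinct_card by fastforce
qed (auto simp: perms_def permutations_of_set_def)

lemma perms_upt: "[1..<Suc n] \<in> perms"
  by (auto simp: perms_iff)

lemma shifted_shuffle_in_perms:
  assumes "s \<in> perms" "t \<in> perms" "w \<in># shifted_shuffle s t"
  shows "w \<in> perms" "length w = length s + length t"
proof -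
  let ?t = "map (\<lambda>x. x + length s) t"
  have w: "mset w = mset (s @ ?t)"
    using assms(3) mset_shuffle unfolding shifted_shuffle_def by blast
  then show len: "length w = length s + length t"
    by (metis length_append length_map size_mset)
  have "set ?t = {1 + length s..length t + length s}"
    using assms(2) image_add_atLeastAtMost'[of "length s" 1 "length t"]
    by (simp add: perms_iff)
  moreover have "distinct ?t"
    using assms(2) by (simp add: perms_iff distinct_map inj_on_def)
  ultimately have "distinct (s @ ?t)" "set (s @ ?t) = {1..length s + length t}"
    using assms(1) by (auto simp: perms_iff)
  then show "w \<in> perms"
    using w len mset_eq_imp_distinct_iff mset_eq_setD unfolding perms_iff by metis
qed

lemma GDes_not_least: "x \<in> GDes w \<Longrightarrow> \<exists>y\<in>set w. y < x"
  by (auto simp: GDes_def)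

text \<open>A descent value is followed by a smaller letter, so it is never 1; after subtracting 1
  it is still a possible partial sum.\<close>

lemma GDes_perm_bounds:
  assumes "s \<in> perms"
  shows "GDes s \<subseteq> {2..length s}"
proof
  fix x assume x: "x \<in> GDes s"
  with GDes_not_least obtain y where "y \<in> set s" "y < x" by blast
  with x GDes_subset[of s] assms show "x \<in> {2..length s}"
    by (auto simp: perms_iff)
qed

text \<open>The description that defines \<open>GC\<close> is met by exactly one composition, by the
  correspondence with subsets of \<open>{1..<n}\<close>. Shifting back by \<open>Suc\<close> loses
  nothing, as descents are at least 2.\<close>

lemma GC_perm:
  assumes "s \<in> perms"
  shows "GC s \<in> compositions (length s)" "GDes s = Suc ` descent_set (GC s)"
proof -
  have "(\<lambda>d. d - 1) ` GDes s \<subseteq> {1..<length s}"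
    using GDes_perm_bounds[OF assms] by fastforce
  then obtain A where A: "A \<in> compositions (length s)" "descent_set A = (\<lambda>d. d - 1) ` GDes s"
    using ex_composition_descent_set by metis
  then have GC: "GC s = A"
    unfolding GC_def by (intro the_equality) (use descent_set_inject in auto)
  with A show "GC s \<in> compositions (length s)" by simp
  have "Suc (d - 1) = d" if "d \<in> GDes s" for d
    using GDes_perm_bounds[OF assms] that by fastforce
  then show "GDes s = Suc ` descent_set (GC s)"
    by (simp add: GC A(2) image_image)
qed

lemma GC_eq_iff:
  assumes "s \<in> perms" "K \<in> compositions (length s)"
  shows "GC s = K \<longleftrightarrow> GDes s = Suc ` descent_set K"
proof
  assume "GDes s = Suc ` descent_set K"
  then have "descent_set (GC s) = descent_set K"
    by (simp add: GC_perm[OF assms(1)] inj_image_eq_iff)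
  then show "GC s = K"
    using GC_perm(1)[OF assms(1)] assms(2) descent_set_inject by blast
qed (use GC_perm(2)[OF assms(1)] in simp)

lemma card_GDes_perm: "s \<in> perms \<Longrightarrow> card (GDes s) = length (GC s) - 1"
  using GC_perm[of s] card_descent_set by (simp add: card_image)

lemma GDes_map_add: "GDes (map (\<lambda>x. x + m) t) = (\<lambda>x. x + m) ` GDes t"
  by (induction t) (auto simp: GDes_Cons hd_map)

text \<open>A nonempty composition has one part more than it has descents, so refinement cannot
  shorten. Length thus measures strict refinement in the triangularity argument.\<close>

lemma descent_set_subset_length:
  assumes "A \<in> compositions n" "C \<in> compositions n" "descent_set A \<subseteq> descent_set C"
  shows "length A \<le> length C" "length A = length C \<Longrightarrow> A = C"
proof -
  have "card (descent_set A) \<le> card (descent_set C)"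
    using assms(3) by (simp add: card_mono)
  then show len: "length A \<le> length C"
    using assms card_descent_set composition_Nil_iff by (cases A; cases C) fastforce+
  assume "length A = length C"
  then have "card (descent_set A) = card (descent_set C)"
    using assms card_descent_set by metis
  then have "descent_set A = descent_set C"
    using assms(3) by (simp add: card_subset_eq)
  with assms show "A = C" by (blast intro: descent_set_inject)
qed

section \<open>Structure constants as numbers of shuffles\<close>

text \<open>\<open>K\<close> must be coarser than \<open>I\<close>, hence not longer; a negative
  lower index gives 0, so only equal lengths remain.\<close>

lemma T_coeff_Nil_right:
  assumes "I \<in> compositions m" "K \<in> compositions m"
  shows "T_coeff I [] K = (if K = I then 1 else 0)"
proof -
  have "descent_set K \<inter> {1..<m} = descent_set K"
    using descent_set_bounds[OF assms(2)] by blast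
  then show ?thesis
    using T_coeff_compositions[of I m "[]" 0 K] assms descent_set_subset_length[OF assms(2,1)]
    by (auto simp: binomial_int_def)
qed

text \<open>Here the upper index is \<open>length J\<close> and the lower one is
  \<open>length K\<close>, while \<open>K\<close> must be finer than \<open>J\<close>; only equal
  lengths contribute.\<close>

lemma T_coeff_Nil_left:
  assumes "J \<in> compositions n" "K \<in> compositions n"
  shows "T_coeff [] J K = (if K = J then 1 else 0)"
  using T_coeff_compositions[of "[]" 0 J n K] assms descent_set_subset_length[OF assms]
  by (auto simp: binomial_int_def binomial_eq_0_iff nat_less_le)

text \<open>Apart from empty words, this is \<open>GDes_count_shuffle\<close> for the target set
  \<open>X\<close> of descent values belonging to \<open>K\<close>. The rest of the proof rewrites
  its conditions and indices in terms of compositions.\<close>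

lemma count_GC_shifted_shuffle:
  assumes s: "s \<in> perms" and t: "t \<in> perms" and K: "K \<in> compositions (length s + length t)"
  shows "size {#w \<in># shifted_shuffle s t. GC w = K#} = T_coeff (GC s) (GC t) K"
proof -
  define m n where "m = length s" and "n = length t"
  define v where "v = map (\<lambda>x. x + m) t"
  define X where "X = Suc ` descent_set K"
  note GCs = GC_perm[OF s, folded m_def] and GCt = GC_perm[OF t, folded n_def]
  have K': "K \<in> compositions (m + n)" using K by (simp add: m_def n_def)
  \<comment> \<open>Empty words are separated: for them the number of parts is not one more than the
    number of descents.\<close>
  consider "m = 0" | "n = 0" | "m > 0" "n > 0" by blast
  then show ?thesis
  proof cases
    case 1
    then have "s = []" "GC s = []" using GCs(1) by (auto simp: m_def)
    then show ?thesis
      using T_coeff_Nil_left[OF GCt(1), of K] K' 1 by (simp add: shifted_shuffle_def)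
  next
    case 2
    then have "t = []" "GC t = []" using GCt(1) by (auto simp: n_def)
    then show ?thesis
      using T_coeff_Nil_right[OF GCs(1), of K] K' 2 by (simp add: shifted_shuffle_def)
  next
    case 3
    have set_s: "set s = {1..m}" and set_v: "set v = {Suc m..m + n}"
      using s t image_add_atLeastAtMost'[of m 1 n]
      by (auto simp: perms_iff v_def m_def n_def add.commute)
    have X: "X \<subseteq> {1..m + n}"
      using descent_set_bounds[OF K'] by (auto simp: X_def)
    have "GC w = K \<longleftrightarrow> GDes w = X \<inter> set w" if "w \<in># shifted_shuffle s t" for w
    proof -
      have w: "w \<in> perms" "length w = m + n"
        using shifted_shuffle_in_perms[OF s t that] by (auto simp: m_def n_def)
      then have "X \<inter> set w = X" using X by (auto simp: perms_iff)
      then show ?thesis using GC_eq_iff[OF w(1)] w(2) K' by (simp add: X_def)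
    qed
    then have "size {#w \<in># shifted_shuffle s t. GC w = K#} = GDes_count (shuffle s v) X"
      unfolding GDes_count_def
      by (intro arg_cong[where f = size] filter_mset_cong) (auto simp: shifted_shuffle_def v_def m_def)
    also have "\<dots> = (if X \<inter> set s \<subseteq> GDes s \<and> GDes v \<subseteq> X
       then binomial_int (m + card (GDes v) - card (GDes s))
         (int (card (X \<inter> set s)) + int (card (X \<inter> set v)) - int (card (GDes s))) else 0)"
      unfolding m_def
    proof (rule GDes_count_shuffle)
      show "s \<noteq> []" using 3 by (auto simp: m_def)
      show "distinct s" "distinct v"
        using s t by (auto simp: perms_iff v_def distinct_map inj_on_def)
      show "x < y" if "x \<in> set s" "y \<in> set v" for x y
        using that set_s set_v by auto
    qed
    \<comment> \<open>The values up to \<open>m\<close> in \<open>X\<close> come from partial sums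
      below \<open>m\<close>. The partial sum \<open>m\<close> becomes the value
      \<open>m + 1\<close>, the least letter of \<open>v\<close>, which neither inclusion
      constrains.\<close>
    also have "X \<inter> set s \<subseteq> GDes s \<longleftrightarrow> descent_set K \<inter> {1..<m} \<subseteq> descent_set (GC s)"
      using descent_set_bounds[OF K'] unfolding X_def GCs(2) set_s
      by (fastforce simp: subset_iff image_iff)
    also have "GDes v \<subseteq> X \<longleftrightarrow> (+) m ` descent_set (GC t) \<subseteq> descent_set K"
      unfolding v_def GDes_map_add GCt(2) X_def by (auto simp: image_subset_iff add.commute)
    also have "int (card (X \<inter> set s)) + int (card (X \<inter> set v)) = int (card (descent_set K))"
    proof -
      have "X = (X \<inter> set s) \<union> (X \<inter> set v)" using X set_s set_v by auto
      moreover have "(X \<inter> set s) \<inter> (X \<inter> set v) = {}" using set_s set_v by auto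
      ultimately have "card X = card (X \<inter> set s) + card (X \<inter> set v)"
        by (metis List.finite_set card_Un_disjoint finite_Int)
      moreover have "card X = card (descent_set K)" by (simp add: X_def card_image)
      ultimately show ?thesis by simp
    qed
    \<comment> \<open>Parts exceed descents by one for each of the compositions, and these
      corrections cancel in both indices.\<close>
    also have "int (card (descent_set K)) - int (card (GDes s)) = int (length K) - int (length (GC s))"
    proof -
      have "K \<noteq> []" "GC s \<noteq> []" using K' GCs(1) 3 by (auto simp: composition_Nil_iff)
      then show ?thesis
        using card_descent_set[OF K'] card_GDes_perm[OF s] by (cases K; cases "GC s") auto
    qed
    also have "m + card (GDes v) - card (GDes s) = m + length (GC t) - length (GC s)"
    proof -
      have "GC t \<noteq> []" "GC s \<noteq> []" using GCt(1) GCs(1) 3 by (auto simp: composition_Nil_iff)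
      moreover have "card (GDes v) = card (GDes t)"
        by (simp add: v_def GDes_map_add card_image)
      ultimately show ?thesis
        using card_GDes_perm[OF s] card_GDes_perm[OF t] by (cases "GC t"; cases "GC s") auto
    qed
    finally show ?thesis
      by (simp add: T_coeff_compositions[OF GCs(1) GCt(1) K'])
  qed
qed

section \<open>Linear extension and based algebras\<close>

lemma lookup_scale [simp]: "Poly_Mapping.lookup (scale c f) x = c * Poly_Mapping.lookup f x"
  by (simp add: scale_def Poly_Mapping.map.rep_eq when_def)

lemma lookup_basis: "Poly_Mapping.lookup (basis b) x = (if x = b then 1 else 0)"
  by (simp add: basis_def lookup_single when_def)

lemma keys_basis [simp]: "Poly_Mapping.keys (basis b :: 'b \<Rightarrow>\<^sub>0 'k::field) = {b}"
  by (simp add: basis_def)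

interpretation scaling: Modules.module "scale :: 'k::field \<Rightarrow> ('b \<Rightarrow>\<^sub>0 'k) \<Rightarrow> ('b \<Rightarrow>\<^sub>0 'k)"
  by unfold_locales (auto intro!: poly_mapping_eqI simp: lookup_add algebra_simps)

lemma keys_scale: "Poly_Mapping.keys (scale c f) \<subseteq> Poly_Mapping.keys f"
  by (auto simp: in_keys_iff)

lemma keys_sum_subset:
  "(\<And>i. i \<in> A \<Longrightarrow> Poly_Mapping.keys (f i) \<subseteq> B) \<Longrightarrow> Poly_Mapping.keys (sum f A) \<subseteq> B"
proof (induction A rule: infinite_finite_induct)
  case (insert i A)
  then show ?case using Poly_Mapping.keys_add[of "f i" "sum f A"] by auto
qed auto

lemma keys_add_subset:
  "Poly_Mapping.keys f \<subseteq> B \<Longrightarrow> Poly_Mapping.keys g \<subseteq> B \<Longrightarrow> Poly_Mapping.keys (f + g) \<subseteq> B"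
  using Poly_Mapping.keys_add[of f g] by blast

lemma keys_diff_subset:
  fixes f g :: "'b \<Rightarrow>\<^sub>0 'k::ab_group_add"
  assumes "Poly_Mapping.keys f \<subseteq> B" "Poly_Mapping.keys g \<subseteq> B"
  shows "Poly_Mapping.keys (f - g) \<subseteq> B"
proof
  fix x assume "x \<in> Poly_Mapping.keys (f - g)"
  then have "x \<in> Poly_Mapping.keys f \<or> x \<in> Poly_Mapping.keys g"
    by (auto simp: in_keys_iff lookup_minus)
  then show "x \<in> B" using assms by blast
qed

lemma keys_sum_mset_subset:
  "(\<And>i. i \<in># M \<Longrightarrow> Poly_Mapping.keys (f i) \<subseteq> B) \<Longrightarrow> Poly_Mapping.keys (\<Sum>i\<in>#M. f i) \<subseteq> B"
  by (induction M) (simp_all add: keys_add_subset)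

text \<open>Passes from numbers of shuffles to coefficients.\<close>

lemma lookup_sum_mset_basis:
  "Poly_Mapping.lookup (\<Sum>w\<in>#M. basis (g w) :: 'b \<Rightarrow>\<^sub>0 'k::field) K = of_nat (size {#w \<in># M. g w = K#})"
  by (induction M) (auto simp: lookup_add lookup_basis)

lemma basis_expansion:
  "f = (\<Sum>u\<in>Poly_Mapping.keys f. scale (Poly_Mapping.lookup f u) (basis u))"
  by (rule poly_mapping_eqI) (simp add: lookup_sum lookup_basis in_keys_iff if_distrib cong: if_cong)

section \<open>Linear and bilinear extension\<close>

definition lin_ext :: "('b \<Rightarrow> ('c \<Rightarrow>\<^sub>0 'k::field)) \<Rightarrow> ('b \<Rightarrow>\<^sub>0 'k) \<Rightarrow> ('c \<Rightarrow>\<^sub>0 'k)" where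
  "lin_ext m f = (\<Sum>u\<in>Poly_Mapping.keys f. scale (Poly_Mapping.lookup f u) (m u))"

lemma lin_ext_superset:
  assumes "finite A" "Poly_Mapping.keys f \<subseteq> A"
  shows "lin_ext m f = (\<Sum>u\<in>A. scale (Poly_Mapping.lookup f u) (m u))"
  unfolding lin_ext_def using assms
  by (intro sum.mono_neutral_left) (auto simp: in_keys_iff)

lemma module_hom_lin_ext: "module_hom scale scale (lin_ext m)"
proof -
  have "lin_ext m (f + g) = lin_ext m f + lin_ext m g" for f g
  proof -
    let ?A = "Poly_Mapping.keys f \<union> Poly_Mapping.keys g"
    have "Poly_Mapping.keys (f + g) \<subseteq> ?A" by (rule Poly_Mapping.keys_add)
    then show ?thesis
      by (simp add: lin_ext_superset[of ?A] lookup_add scaling.scale_left_distrib sum.distrib)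
  qed
  moreover have "lin_ext m (scale c f) = scale c (lin_ext m f)" for c f
    unfolding lin_ext_superset[OF finite_keys keys_scale]
    by (simp add: lin_ext_def scaling.scale_sum_right)
  ultimately show ?thesis
    by (simp add: module_hom_iff scaling.module_axioms)
qed

lemma lin_ext_basis [simp]: "lin_ext m (basis u) = m u"
  by (simp add: lin_ext_def lookup_basis)

lemma keys_lin_ext:
  "(\<And>u. u \<in> Poly_Mapping.keys f \<Longrightarrow> Poly_Mapping.keys (m u) \<subseteq> B) \<Longrightarrow> Poly_Mapping.keys (lin_ext m f) \<subseteq> B"
  unfolding lin_ext_def by (intro keys_sum_subset order_trans[OF keys_scale])

lemma module_hom_expand:
  assumes "module_hom scale scale F"
  shows "F f = lin_ext (\<lambda>u. F (basis u)) f"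
proof -
  interpret module_hom scale scale F by fact
  show ?thesis
    by (subst basis_expansion[of f]) (simp add: sum scale lin_ext_def)
qed

text \<open>Both values are combinations over the support of \<open>f\<close>. Multilinear
  identities can thus be checked one argument at a time, on basis vectors that satisfy the side
  conditions.\<close>

lemma module_hom_eq_on_keys:
  assumes "module_hom scale scale F" "module_hom scale scale G"
    and "\<And>u. u \<in> Poly_Mapping.keys f \<Longrightarrow> F (basis u) = G (basis u)"
  shows "F f = G f"
proof -
  have "F f = lin_ext (\<lambda>u. F (basis u)) f" by (rule module_hom_expand[OF assms(1)])
  also have "\<dots> = lin_ext (\<lambda>u. G (basis u)) f" by (simp add: lin_ext_def assms(3))
  also have "\<dots> = G f" by (rule module_hom_expand[OF assms(2), symmetric])
  finally show ?thesis .
qed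

lemma module_hom_sum_mset:
  assumes "module_hom scale scale F"
  shows "F (\<Sum>w\<in>#M. p w) = (\<Sum>w\<in>#M. F (p w))"
proof -
  interpret module_hom scale scale F by fact
  show ?thesis by (induction M) (auto simp: add)
qed

lemma module_hom_o:
  "module_hom scale scale F \<Longrightarrow> module_hom scale scale G \<Longrightarrow> module_hom scale scale (\<lambda>x. F (G x))"
  by (simp add: module_hom_iff)

lemma bilinear_ext_eq: "bilinear_ext m f g = lin_ext (\<lambda>u. lin_ext (m u) g) f"
  by (simp add: bilinear_ext_def lin_ext_def scaling.scale_sum_right)

lemma module_hom_bilinear_ext_left: "module_hom scale scale (\<lambda>f. bilinear_ext m f g)"
  unfolding bilinear_ext_eq by (rule module_hom_lin_ext)

lemma module_hom_bilinear_ext_right: "module_hom scale scale (bilinear_ext m f)"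
  unfolding module_hom_iff bilinear_ext_eq
  by (simp add: scaling.module_axioms lin_ext_def[of _ f] module_hom.add[OF module_hom_lin_ext]
      module_hom.scale[OF module_hom_lin_ext] scaling.scale_right_distrib sum.distrib
      scaling.scale_sum_right mult.commute)

lemma bilinear_ext_basis [simp]: "bilinear_ext m (basis u) (basis v) = m u v"
  by (simp add: bilinear_ext_eq)

lemma keys_bilinear_ext:
  assumes "\<And>u v. u \<in> B \<Longrightarrow> v \<in> C \<Longrightarrow> Poly_Mapping.keys (m u v) \<subseteq> D"
    and "Poly_Mapping.keys f \<subseteq> B" "Poly_Mapping.keys g \<subseteq> C"
  shows "Poly_Mapping.keys (bilinear_ext m f g) \<subseteq> D"
  unfolding bilinear_ext_eq using assms by (intro keys_lin_ext) blast

lemmas bilinear_ext_add_left = module_hom.add[OF module_hom_bilinear_ext_left]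
lemmas bilinear_ext_add_right = module_hom.add[OF module_hom_bilinear_ext_right]

lemma based_algebra_simps [simp]:
  "carrier (based_algebra B e m) = {f. Poly_Mapping.keys f \<subseteq> B}"
  "monoid.mult (based_algebra B e m) = bilinear_ext m"
  "one (based_algebra B e m) = basis e"
  "zero (based_algebra B e m) = 0"
  "add (based_algebra B e m) = (+)"
  "smult (based_algebra B e m) = scale"
  by (simp_all add: based_algebra_def)

text \<open>Both sides are linear in each argument; the identity is extended from basis vectors
  first in \<open>z\<close>, then in \<open>y\<close>, then in \<open>x\<close>.\<close>

lemma bilinear_ext_assoc:
  assumes "\<And>u v w. u \<in> B \<Longrightarrow> v \<in> B \<Longrightarrow> w \<in> B \<Longrightarrow>
      bilinear_ext m (m u v) (basis w) = bilinear_ext m (basis u) (m v w)"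
    and "Poly_Mapping.keys x \<subseteq> B" "Poly_Mapping.keys y \<subseteq> B" "Poly_Mapping.keys z \<subseteq> B"
  shows "bilinear_ext m (bilinear_ext m x y) z = bilinear_ext m x (bilinear_ext m y z)"
proof -
  note hom = module_hom_bilinear_ext_left module_hom_bilinear_ext_right
  have 1: "bilinear_ext m (m u v) z = bilinear_ext m (basis u) (bilinear_ext m (basis v) z)"
    if "u \<in> B" "v \<in> B" for u v
    by (rule module_hom_eq_on_keys[where F = "bilinear_ext m (m u v)"])
      (use that assms in \<open>auto intro!: hom module_hom_o[OF hom(2) hom(2)]\<close>)
  have 2: "bilinear_ext m (bilinear_ext m (basis u) y) z = bilinear_ext m (basis u) (bilinear_ext m y z)"
    if "u \<in> B" for u
    by (rule module_hom_eq_on_keys[where F = "\<lambda>y. bilinear_ext m (bilinear_ext m (basis u) y) z"])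
      (use that 1 assms in \<open>auto intro!: module_hom_o[OF hom(1) hom(2)] module_hom_o[OF hom(2) hom(1)]\<close>)
  show ?thesis
    by (rule module_hom_eq_on_keys[where F = "\<lambda>x. bilinear_ext m (bilinear_ext m x y) z"])
      (use 2 assms in \<open>auto intro!: module_hom_o[OF hom(1) hom(1)] hom\<close>)
qed

lemma ring_based_algebra:
  assumes "e \<in> B" "\<And>u v. u \<in> B \<Longrightarrow> v \<in> B \<Longrightarrow> Poly_Mapping.keys (m u v) \<subseteq> B"
    and "\<And>u. u \<in> B \<Longrightarrow> m e u = basis u" "\<And>u. u \<in> B \<Longrightarrow> m u e = basis u"
    and "\<And>u v w. u \<in> B \<Longrightarrow> v \<in> B \<Longrightarrow> w \<in> B \<Longrightarrow>
      bilinear_ext m (m u v) (basis w) = bilinear_ext m (basis u) (m v w)"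
  shows "ring (based_algebra B e m)"
proof (intro ringI abelian_groupI monoidI, simp_all only: based_algebra_simps mem_Collect_eq)
  fix x :: "'a \<Rightarrow>\<^sub>0 'b"
  assume x: "Poly_Mapping.keys x \<subseteq> B"
  show "\<exists>y\<in>{f. Poly_Mapping.keys f \<subseteq> B}. y + x = 0"
    using x by (intro bexI[of _ "- x"]) auto
  show "bilinear_ext m (basis e) x = x"
    by (rule module_hom_eq_on_keys[where G = "\<lambda>x. x"])
      (use x assms in \<open>auto intro!: module_hom_bilinear_ext_right scaling.module_hom_ident\<close>)
  show "bilinear_ext m x (basis e) = x"
    by (rule module_hom_eq_on_keys[where G = "\<lambda>x. x"])
      (use x assms in \<open>auto intro!: module_hom_bilinear_ext_left scaling.module_hom_ident\<close>)
next
  fix x y :: "'a \<Rightarrow>\<^sub>0 'b"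
  assume "Poly_Mapping.keys x \<subseteq> B" "Poly_Mapping.keys y \<subseteq> B"
  then show "Poly_Mapping.keys (bilinear_ext m x y) \<subseteq> B"
    using keys_bilinear_ext[of B B] assms(2) by blast
  show "Poly_Mapping.keys (x + y) \<subseteq> B"
    by (rule keys_add_subset) fact+
qed (use assms in \<open>auto intro!: bilinear_ext_assoc[where B = B]
  simp: bilinear_ext_add_left bilinear_ext_add_right add.assoc add.commute\<close>)

section \<open>The kernel of the G-composition map\<close>

lemma shuffle_map: "shuffle (map f u) (map f v) = image_mset (map f) (shuffle u v)"
  by (induction u v rule: shuffle.induct) (auto simp: multiset.map_comp o_def)

lemma image_mset_sum_mset: "image_mset f (\<Sum>x\<in>#M. g x) = (\<Sum>x\<in>#M. image_mset f (g x))"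
  by (induction M) auto

text \<open>Both sides list the shuffles of three words. Grouped by the word supplying the first
  letter, the groups agree by induction.\<close>

lemma shuffle_assoc: "(\<Sum>x\<in>#shuffle u v. shuffle x w) = (\<Sum>y\<in>#shuffle v w. shuffle u y)"
proof (induction "length u + length v + length w" arbitrary: u v w rule: less_induct)
  case less
  show ?case
  proof (cases "u = [] \<or> v = [] \<or> w = []")
    case True
    have "(\<Sum>x\<in>#M. {#x#}) = M" for M :: "'a list multiset" by (induction M) auto
    moreover have "shuffle [] = (\<lambda>y :: 'a list. {#y#})" by (rule ext) simp
    ultimately show ?thesis using True by auto
  next
    case False
    then obtain a u' b v' c w' where uvw: "u = a # u'" "v = b # v'" "w = c # w'"
      by (metis neq_Nil_conv)
    have IH: "(\<Sum>x\<in>#shuffle u' v. shuffle x w) = (\<Sum>y\<in>#shuffle v w. shuffle u' y)"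
      "(\<Sum>x\<in>#shuffle u v'. shuffle x w) = (\<Sum>y\<in>#shuffle v' w. shuffle u y)"
      "(\<Sum>x\<in>#shuffle u v. shuffle x w') = (\<Sum>y\<in>#shuffle v w'. shuffle u y)"
      by (rule less.hyps; simp add: uvw)+
    have "(\<Sum>x\<in>#shuffle u v. shuffle x w) =
        image_mset ((#) a) (\<Sum>x\<in>#shuffle u' v. shuffle x w) +
        image_mset ((#) b) (\<Sum>x\<in>#shuffle u v'. shuffle x w) +
        image_mset ((#) c) (\<Sum>x\<in>#shuffle u v. shuffle x w')"
      by (simp add: uvw multiset.map_comp o_def sum_mset.distrib image_mset_sum_mset)
    also have "\<dots> = image_mset ((#) a) (\<Sum>y\<in>#shuffle v w. shuffle u' y) +
        image_mset ((#) b) (\<Sum>y\<in>#shuffle v' w. shuffle u y) +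
        image_mset ((#) c) (\<Sum>y\<in>#shuffle v w'. shuffle u y)"
      by (simp only: IH)
    also have "\<dots> = (\<Sum>y\<in>#shuffle v w. shuffle u y)"
      by (simp add: uvw multiset.map_comp o_def sum_mset.distrib image_mset_sum_mset)
    finally show ?thesis .
  qed
qed

text \<open>Every shuffle of \<open>s\<close> with the shifted \<open>t\<close> has length
  \<open>length s + length t\<close>, so both bracketings shift \<open>r\<close> by the same
  amount.\<close>

lemma shifted_shuffle_assoc:
  "(\<Sum>x\<in>#shifted_shuffle s t. shifted_shuffle x r) = (\<Sum>y\<in>#shifted_shuffle t r. shifted_shuffle s y)"
proof -
  let ?t = "map (\<lambda>x. x + length s) t" and ?r = "map (\<lambda>x. x + (length s + length t)) r"
  have len: "length x = length s + length t" if "x \<in># shuffle s ?t" for x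
    using mset_shuffle[OF that] by (metis length_append length_map size_mset)
  have "(\<Sum>x\<in>#shifted_shuffle s t. shifted_shuffle x r) = (\<Sum>x\<in>#shuffle s ?t. shuffle x ?r)"
    unfolding shifted_shuffle_def by (intro arg_cong[where f = sum_mset] image_mset_cong) (simp add: len)
  also have "\<dots> = (\<Sum>y\<in>#shuffle ?t ?r. shuffle s y)"
    by (rule shuffle_assoc)
  also have "?r = map (\<lambda>x. x + length s) (map (\<lambda>x. x + length t) r)"
    by (simp add: o_def add_ac)
  also have "(\<Sum>y\<in>#shuffle ?t \<dots>. shuffle s y) = (\<Sum>y\<in>#shifted_shuffle t r. shifted_shuffle s y)"
    unfolding shuffle_map by (simp add: shifted_shuffle_def multiset.map_comp o_def)
  finally show ?thesis .
qed

abbreviation F_prod :: "nat list \<Rightarrow> nat list \<Rightarrow> (nat list \<Rightarrow>\<^sub>0 'k::field)" where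
  "F_prod s t \<equiv> \<Sum>w\<in>#shifted_shuffle s t. basis w"

lemma keys_F_prod:
  "s \<in> perms \<Longrightarrow> t \<in> perms \<Longrightarrow> Poly_Mapping.keys (F_prod s t :: nat list \<Rightarrow>\<^sub>0 'k::field) \<subseteq> perms"
  by (rule keys_sum_mset_subset) (simp, rule shifted_shuffle_in_perms(1))

lemma sum_mset_sum_mset_image:
  fixes f :: "'a \<Rightarrow> 'b::comm_monoid_add"
  shows "(\<Sum>x\<in>#M. \<Sum>y\<in>#g x. f y) = (\<Sum>y\<in>#(\<Sum>x\<in>#M. g x). f y)"
  by (induction M) auto

lemma F_prod_assoc:
  "bilinear_ext F_prod (F_prod s t) (basis r) = bilinear_ext F_prod (basis s) (F_prod t r)"
  by (simp add: module_hom_sum_mset[OF module_hom_bilinear_ext_left]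
      module_hom_sum_mset[OF module_hom_bilinear_ext_right]
      sum_mset_sum_mset_image shifted_shuffle_assoc)

lemma bilinear_ext_F_prod_assoc:
  "bilinear_ext F_prod (bilinear_ext F_prod x y) z = bilinear_ext F_prod x (bilinear_ext F_prod y z)"
  by (rule bilinear_ext_assoc[of UNIV]) (simp_all add: F_prod_assoc)

lemma FQSym_simps [simp]:
  "carrier FQSym = {f. Poly_Mapping.keys f \<subseteq> perms}"
  "monoid.mult FQSym = bilinear_ext F_prod"
  "one FQSym = basis []"
  "zero FQSym = 0"
  "add FQSym = (+)"
  "smult FQSym = scale"
  by (simp_all add: FQSym_def)

lemma Nil_in_perms [simp]: "[] \<in> perms"
  by (simp add: perms_iff)

lemma ring_FQSym: "ring (FQSym :: ('k::field, nat list \<Rightarrow>\<^sub>0 'k) module)"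
  unfolding FQSym_def
  by (rule ring_based_algebra) (simp_all add: keys_F_prod F_prod_assoc, simp_all add: shifted_shuffle_def)

section \<open>The quotient in coordinates\<close>

text \<open>A coordinate model of the quotient map, in which the class \<open>T_I\<close> becomes
  the basis vector \<open>I\<close>; \<open>T_prod\<close> is the corresponding product.\<close>

definition GC_map :: "(nat list \<Rightarrow>\<^sub>0 'k::field) \<Rightarrow> (nat list \<Rightarrow>\<^sub>0 'k)" where
  "GC_map = lin_ext (\<lambda>s. basis (GC s))"

definition T_prod :: "nat list \<Rightarrow> nat list \<Rightarrow> (nat list \<Rightarrow>\<^sub>0 'k::field)" where
  "T_prod I J = (\<Sum>K\<in>compositions (sum_list I + sum_list J). scale (of_nat (T_coeff I J K)) (basis K))"

lemma module_hom_GC_map: "module_hom scale scale GC_map"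
  unfolding GC_map_def by (rule module_hom_lin_ext)

lemmas GC_map_add = module_hom.add[OF module_hom_GC_map]
lemmas GC_map_diff = module_hom.diff[OF module_hom_GC_map]
lemmas GC_map_scale = module_hom.scale[OF module_hom_GC_map]
lemmas GC_map_sum = module_hom.sum[OF module_hom_GC_map]

lemma GC_map_basis [simp]: "GC_map (basis s) = basis (GC s)"
  by (simp add: GC_map_def)

lemma lookup_T_prod:
  "Poly_Mapping.lookup (T_prod I J :: nat list \<Rightarrow>\<^sub>0 'k::field) K =
    (if K \<in> compositions (sum_list I + sum_list J) then of_nat (T_coeff I J K) else 0)"
  by (simp add: T_prod_def lookup_sum lookup_basis if_distrib cong: if_cong)

lemma GC_map_F_prod:
  assumes "s \<in> perms" "t \<in> perms"
  shows "GC_map (F_prod s t :: nat list \<Rightarrow>\<^sub>0 'k::field) = T_prod (GC s) (GC t)"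
proof (rule poly_mapping_eqI)
  fix K
  note GC = GC_perm(1)[OF assms(1)] GC_perm(1)[OF assms(2)]
  have sum: "sum_list (GC s) + sum_list (GC t) = length s + length t"
    using GC by (simp add: sum_list_composition)
  have "Poly_Mapping.lookup (GC_map (F_prod s t :: nat list \<Rightarrow>\<^sub>0 'k)) K =
      of_nat (size {#w \<in># shifted_shuffle s t. GC w = K#})"
    by (simp add: module_hom_sum_mset[OF module_hom_GC_map] lookup_sum_mset_basis)
  also have "\<dots> = Poly_Mapping.lookup (T_prod (GC s) (GC t)) K"
  proof (cases "K \<in> compositions (length s + length t)")
    case True
    then show ?thesis
      by (simp add: count_GC_shifted_shuffle[OF assms] lookup_T_prod sum)
  next
    case False
    \<comment> \<open>All shuffles have the same length, so only compositions of that size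
      occur.\<close>
    have "GC w \<noteq> K" if "w \<in># shifted_shuffle s t" for w
      using GC_perm(1)[OF shifted_shuffle_in_perms(1)[OF assms that]]
        shifted_shuffle_in_perms(2)[OF assms that] False by auto
    then have "{#w \<in># shifted_shuffle s t. GC w = K#} = {#}"
      by simp
    with False show ?thesis
      by (simp only: lookup_T_prod sum size_empty of_nat_0 if_False)
  qed
  finally show "Poly_Mapping.lookup (GC_map (F_prod s t :: nat list \<Rightarrow>\<^sub>0 'k)) K = \<dots>" .
qed

lemma GC_map_mult:
  fixes x y :: "nat list \<Rightarrow>\<^sub>0 'k::field"
  assumes "Poly_Mapping.keys x \<subseteq> perms" "Poly_Mapping.keys y \<subseteq> perms"
  shows "GC_map (bilinear_ext F_prod x y) = bilinear_ext T_prod (GC_map x) (GC_map y)"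
proof -
  note homl = module_hom_bilinear_ext_left and homr = module_hom_bilinear_ext_right
  have 1: "GC_map (bilinear_ext F_prod (basis s) y) = bilinear_ext T_prod (GC_map (basis s)) (GC_map y)"
    if "s \<in> perms" for s
  proof (rule module_hom_eq_on_keys[where f = y])
    show "GC_map (bilinear_ext F_prod (basis s) (basis t)) =
        bilinear_ext T_prod (GC_map (basis s)) (GC_map (basis t))"
      if "t \<in> Poly_Mapping.keys y" for t
      using GC_map_F_prod[of s t] \<open>s \<in> perms\<close> that assms by auto
    show "module_hom scale scale (\<lambda>y. GC_map (bilinear_ext F_prod (basis s) y))"
      by (rule module_hom_o[OF module_hom_GC_map homr])
    show "module_hom scale scale (\<lambda>y. bilinear_ext T_prod (GC_map (basis s)) (GC_map y))"
      by (rule module_hom_o[OF homr module_hom_GC_map])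
  qed
  show ?thesis
  proof (rule module_hom_eq_on_keys[where f = x])
    show "module_hom scale scale (\<lambda>x. GC_map (bilinear_ext F_prod x y))"
      by (rule module_hom_o[OF module_hom_GC_map homl])
    show "module_hom scale scale (\<lambda>x. bilinear_ext T_prod (GC_map x) (GC_map y))"
      by (rule module_hom_o[OF homl module_hom_GC_map])
  qed (use 1 assms in auto)
qed

text \<open>The generators of the span are in the kernel. Conversely, replacing each permutation by
  a fixed representative of its class factors through \<open>GC_map\<close>, so it sends a kernel
  element to 0; subtracting this 0 displays the element as a combination of generators.\<close>

lemma GC_ideal_eq:
  "(GC_ideal :: (nat list \<Rightarrow>\<^sub>0 'k::field) set) = {x. Poly_Mapping.keys x \<subseteq> perms \<and> GC_map x = 0}"
proof
  let ?D = "{basis s - basis t :: nat list \<Rightarrow>\<^sub>0 'k | s t. s \<in> perms \<and> t \<in> perms \<and> length s = length t \<and> GC s = GC t}"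
  let ?N = "{x :: nat list \<Rightarrow>\<^sub>0 'k. Poly_Mapping.keys x \<subseteq> perms \<and> GC_map x = 0}"
  show "GC_ideal \<subseteq> ?N"
    unfolding GC_ideal_def
  proof (rule scaling.span_minimal)
    show "?D \<subseteq> ?N"
    proof
      fix x assume "x \<in> ?D"
      then obtain s t where "x = basis s - basis t" "s \<in> perms" "t \<in> perms" "GC s = GC t"
        by blast
      then show "x \<in> ?N" by (simp add: GC_map_diff keys_diff_subset)
    qed
    show "scaling.subspace ?N"
      unfolding scaling.subspace_def
      by (simp add: GC_map_add GC_map_scale module_hom.zero[OF module_hom_GC_map]
        keys_add_subset order_trans[OF keys_scale])
  qed
  show "?N \<subseteq> GC_ideal"
  proof
    fix x :: "nat list \<Rightarrow>\<^sub>0 'k" assume "x \<in> ?N"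
    then have x: "Poly_Mapping.keys x \<subseteq> perms" "GC_map x = 0" by auto
    define rep where "rep I = (SOME s. s \<in> perms \<and> GC s = I)" for I
    have rep: "rep (GC s) \<in> perms" "GC (rep (GC s)) = GC s" if "s \<in> perms" for s
      using someI[of "\<lambda>s'. s' \<in> perms \<and> GC s' = GC s" s] that by (auto simp: rep_def)
    have "lin_ext (\<lambda>I. basis (rep I)) (GC_map x) = lin_ext (\<lambda>s. basis (rep (GC s))) x"
      by (rule module_hom_eq_on_keys[where f = x])
        (simp_all add: module_hom_lin_ext module_hom_o[OF module_hom_lin_ext module_hom_GC_map])
    then have "lin_ext (\<lambda>s. basis (rep (GC s))) x = 0"
      using x(2) by (simp add: lin_ext_def)
    then have "x = (\<Sum>s\<in>Poly_Mapping.keys x. scale (Poly_Mapping.lookup x s) (basis s - basis (rep (GC s))))"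
      using basis_expansion[of x] by (simp add: lin_ext_def scaling.scale_right_diff_distrib sum_subtractf)
    also have "\<dots> \<in> GC_ideal"
      unfolding GC_ideal_def
    proof (intro scaling.span_sum scaling.span_scale scaling.span_base)
      fix s assume "s \<in> Poly_Mapping.keys x"
      then have s: "s \<in> perms" using x by blast
      note r = rep[OF s]
      have "length s = length (rep (GC s))"
        using GC_perm(1)[OF s] GC_perm(1)[OF r(1)] r(2) by (metis sum_list_composition)
      then show "basis s - basis (rep (GC s)) \<in> ?D"
        using s r by force
    qed
    finally show "x \<in> GC_ideal" .
  qed
qed

text \<open>\<open>GC_map\<close> is multiplicative by \<open>GC_map_mult\<close>, so its kernel
  absorbs products from both sides.\<close>

lemma ideal_GC_ideal: "ideal GC_ideal (FQSym :: ('k::field, nat list \<Rightarrow>\<^sub>0 'k) module)"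
proof (rule idealI[OF ring_FQSym])
  interpret ring "FQSym :: ('k::field, nat list \<Rightarrow>\<^sub>0 'k) module" by (rule ring_FQSym)
  show "subgroup GC_ideal (add_monoid (FQSym :: ('k, nat list \<Rightarrow>\<^sub>0 'k) module))"
  proof (rule add.subgroupI)
    show "GC_ideal \<subseteq> carrier (FQSym :: ('k, nat list \<Rightarrow>\<^sub>0 'k) module)"
      by (auto simp: GC_ideal_eq)
    show "GC_ideal \<noteq> ({} :: (nat list \<Rightarrow>\<^sub>0 'k) set)"
      using scaling.span_zero unfolding GC_ideal_def by blast
    fix a b :: "nat list \<Rightarrow>\<^sub>0 'k" assume a: "a \<in> GC_ideal" and b: "b \<in> GC_ideal"
    have "\<ominus>\<^bsub>FQSym\<^esub> a = - a"
      by (rule minus_equality) (use a in \<open>auto simp: GC_ideal_eq\<close>)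
    then show "\<ominus>\<^bsub>FQSym\<^esub> a \<in> GC_ideal"
      using a scaling.span_neg unfolding GC_ideal_def by simp
    show "a \<oplus>\<^bsub>FQSym\<^esub> b \<in> GC_ideal"
      using a b scaling.span_add unfolding GC_ideal_def by simp
  qed
  fix a x :: "nat list \<Rightarrow>\<^sub>0 'k" assume "a \<in> GC_ideal" "x \<in> carrier FQSym"
  then have ax: "Poly_Mapping.keys a \<subseteq> perms" "Poly_Mapping.keys x \<subseteq> perms" "GC_map a = 0"
    by (auto simp: GC_ideal_eq)
  show "x \<otimes>\<^bsub>FQSym\<^esub> a \<in> GC_ideal"
    using ax keys_bilinear_ext[OF keys_F_prod ax(2,1)]
    by (simp add: GC_ideal_eq GC_map_mult module_hom.zero[OF module_hom_bilinear_ext_right])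
  show "a \<otimes>\<^bsub>FQSym\<^esub> x \<in> GC_ideal"
    using ax keys_bilinear_ext[OF keys_F_prod ax(1,2)]
    by (simp add: GC_ideal_eq GC_map_mult module_hom.zero[OF module_hom_bilinear_ext_left])
qed

text \<open>Cosets are fibres of \<open>GC_map\<close>, so classes can be compared by their
  coordinates.\<close>

lemma GC_ideal_coset:
  fixes x :: "nat list \<Rightarrow>\<^sub>0 'k::field"
  assumes "Poly_Mapping.keys x \<subseteq> perms"
  shows "GC_ideal +>\<^bsub>FQSym\<^esub> x = {z. Poly_Mapping.keys z \<subseteq> perms \<and> GC_map z = GC_map x}"
proof -
  have "GC_ideal +>\<^bsub>FQSym\<^esub> x = (\<lambda>j. j + x) ` GC_ideal"
    by (auto simp: a_r_coset_def')
  also have "\<dots> = {z. Poly_Mapping.keys z \<subseteq> perms \<and> GC_map z = GC_map x}"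
  proof (intro subset_antisym subsetI)
    fix z assume "z \<in> {z. Poly_Mapping.keys z \<subseteq> perms \<and> GC_map z = GC_map x}"
    then have "z - x \<in> GC_ideal"
      using keys_diff_subset[OF _ assms] by (auto simp: GC_ideal_eq GC_map_diff)
    then show "z \<in> (\<lambda>j. j + x) ` GC_ideal" by (intro image_eqI[of _ _ "z - x"]) auto
  next
    fix z assume "z \<in> (\<lambda>j. j + x) ` GC_ideal"
    then show "z \<in> {z. Poly_Mapping.keys z \<subseteq> perms \<and> GC_map z = GC_map x}"
      using keys_add_subset[OF _ assms] by (auto simp: GC_ideal_eq GC_map_add)
  qed
  finally show ?thesis .
qed

section \<open>Triangularity of the products of generators\<close>

lemma lists_iff_composition: "w \<in> lists {1..} \<longleftrightarrow> w \<in> compositions (sum_list w)"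
  by (auto simp: compositions_def lists_eq_set Suc_le_eq intro: ccontr)

lemma composition_in_lists: "w \<in> compositions n \<Longrightarrow> w \<in> lists {1..}"
  by (auto simp: compositions_def lists_eq_set Suc_le_eq intro: ccontr)

text \<open>\<open>[n]\<close> has no descents, so no partial sum of \<open>K\<close> lies below
  \<open>n\<close>. If the first part equals \<open>n\<close>, removing it turns the second
  inclusion into refinement of \<open>J\<close>.\<close>

lemma T_prod_row_support:
  assumes J: "J \<in> lists {1..}" and n: "n \<ge> 1"
    and K: "Poly_Mapping.lookup (T_prod [n] J :: nat list \<Rightarrow>\<^sub>0 'k::field) K \<noteq> 0"
  shows "K \<in> compositions (n + sum_list J)" "K \<noteq> []" "n \<le> hd K"
    "hd K = n \<Longrightarrow> descent_set J \<subseteq> descent_set (tl K)"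
proof -
  have J': "J \<in> compositions (sum_list J)" using J lists_iff_composition by blast
  have I': "[n] \<in> compositions n" using n by (simp add: compositions_Cons_iff)
  show KC: "K \<in> compositions (n + sum_list J)"
    using K by (simp add: lookup_T_prod split: if_splits)
  then show "K \<noteq> []" using n by auto
  then obtain h T where hT: "K = h # T" by (cases K) auto
  have "T_coeff [n] J K \<noteq> 0"
    using K KC by (intro notI) (simp add: lookup_T_prod)
  then have D: "descent_set K \<inter> {1..<n} = {}" "(+) n ` descent_set J \<subseteq> descent_set K"
    by (auto simp: T_coeff_compositions[OF I' J' KC] descent_set_Cons[of n] split: if_splits)
  have h: "0 < h" "T = [] \<Longrightarrow> h = n + sum_list J"
    using KC by (auto simp: hT compositions_Cons_iff)
  show "n \<le> hd K"
    using D(1) h by (cases "T = []") (auto simp: hT descent_set_Cons)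
  show "descent_set J \<subseteq> descent_set (tl K)" if "hd K = n"
  proof (cases "T = []")
    case True
    then have "sum_list J = 0" using h(2) that by (simp add: hT)
    then have "J = []" using J' by (simp only: compositions_0) simp
    then show ?thesis by simp
  next
    case False
    have "0 \<notin> descent_set J" using descent_set_bounds[OF J'] by auto
    then show ?thesis using D(2) False that by (auto simp: hT descent_set_Cons)
  qed
qed

text \<open>The coefficient is \<open>(n + length J - 1) choose length J\<close>, which is positive
  since \<open>n \<ge> 1\<close>, and remains nonzero in characteristic zero.\<close>

lemma T_prod_row_diagonal:
  assumes J: "J \<in> lists {1..}" and n: "n \<ge> 1"
  shows "Poly_Mapping.lookup (T_prod [n] J :: nat list \<Rightarrow>\<^sub>0 'k::field_char_0) (n # J) \<noteq> 0"
proof -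
  have J': "J \<in> compositions (sum_list J)" using J lists_iff_composition by blast
  have I': "[n] \<in> compositions n" and K': "n # J \<in> compositions (n + sum_list J)"
    using n J' by (simp_all add: compositions_Cons_iff)
  have "descent_set (n # J) \<inter> {1..<n} = {}" "(+) n ` descent_set J \<subseteq> descent_set (n # J)"
    by (auto simp: descent_set_Cons)
  then have "T_coeff [n] J (n # J) = (n + length J - 1) choose length J"
    using T_coeff_compositions[OF I' J' K'] by (auto simp: binomial_int_def)
  moreover have "length J \<le> n + length J - 1" using n by simp
  ultimately show ?thesis
    using K' by (simp add: lookup_T_prod)
qed

section \<open>Products of the generators\<close>

text \<open>Lifts the map on words to \<open>FQSym\<close> before passing to the quotient: the
  letter \<open>n\<close> stands for the identity permutation of size \<open>n\<close>.\<close>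

fun F_word :: "nat list \<Rightarrow> (nat list \<Rightarrow>\<^sub>0 'k::field)" where
  "F_word [] = basis []"
| "F_word (n # w) = bilinear_ext F_prod (basis [1..<Suc n]) (F_word w)"

definition Sym_map :: "(nat list \<Rightarrow>\<^sub>0 'k::field) \<Rightarrow> (nat list \<Rightarrow>\<^sub>0 'k)" where
  "Sym_map = lin_ext F_word"

lemma keys_F_word: "Poly_Mapping.keys (F_word w :: nat list \<Rightarrow>\<^sub>0 'k::field) \<subseteq> perms"
proof (induction w)
  case (Cons n w)
  have "Poly_Mapping.keys (basis [1..<Suc n] :: nat list \<Rightarrow>\<^sub>0 'k) \<subseteq> perms"
    using perms_upt by simp
  from keys_bilinear_ext[OF keys_F_prod this Cons] show ?case by simp
qed simp

lemma F_prod_one_left: "bilinear_ext F_prod (basis []) x = x"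
  by (rule module_hom_eq_on_keys[where G = "\<lambda>x. x"])
    (simp_all add: module_hom_bilinear_ext_right scaling.module_hom_ident shifted_shuffle_def)

lemma F_word_append: "F_word (u @ v) = bilinear_ext F_prod (F_word u) (F_word v)"
  by (induction u) (simp_all add: F_prod_one_left bilinear_ext_F_prod_assoc)

lemma module_hom_Sym_map: "module_hom scale scale Sym_map"
  unfolding Sym_map_def by (rule module_hom_lin_ext)

lemma keys_Sym_map: "Poly_Mapping.keys (Sym_map x) \<subseteq> perms"
  unfolding Sym_map_def by (rule keys_lin_ext) (rule keys_F_word)

lemma Sym_map_mult:
  "Sym_map (bilinear_ext (\<lambda>u v. basis (u @ v)) x y) = bilinear_ext F_prod (Sym_map x) (Sym_map y)"
proof -
  note homl = module_hom_bilinear_ext_left and homr = module_hom_bilinear_ext_right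
  have 1: "Sym_map (bilinear_ext (\<lambda>u v. basis (u @ v)) (basis u) y) =
      bilinear_ext F_prod (Sym_map (basis u)) (Sym_map y)" for u
  proof (rule module_hom_eq_on_keys[where f = y])
    show "module_hom scale scale (\<lambda>y. Sym_map (bilinear_ext (\<lambda>u v. basis (u @ v)) (basis u) y))"
      by (rule module_hom_o[OF module_hom_Sym_map homr])
    show "module_hom scale scale (\<lambda>y. bilinear_ext F_prod (Sym_map (basis u)) (Sym_map y))"
      by (rule module_hom_o[OF homr module_hom_Sym_map])
  qed (simp add: Sym_map_def F_word_append)
  show ?thesis
  proof (rule module_hom_eq_on_keys[where f = x])
    show "module_hom scale scale (\<lambda>x. Sym_map (bilinear_ext (\<lambda>u v. basis (u @ v)) x y))"
      by (rule module_hom_o[OF module_hom_Sym_map homl])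
    show "module_hom scale scale (\<lambda>x. bilinear_ext F_prod (Sym_map x) (Sym_map y))"
      by (rule module_hom_o[OF homl module_hom_Sym_map])
  qed (rule 1)
qed

lemma sorted_GDes: "sorted w \<Longrightarrow> GDes w = {}"
proof (induction w)
  case (Cons a w)
  then show ?case by (cases w) (auto simp: GDes_Cons)
qed simp

lemma GC_upt: "n \<ge> 1 \<Longrightarrow> GC [1..<Suc n] = [n]"
  using GC_eq_iff[OF perms_upt, of "[n]" n]
  by (simp add: compositions_Cons_iff sorted_GDes descent_set_Cons del: upt_Suc)

text \<open>The coordinates of the product of the classes \<open>T_(n)\<close>, for \<open>n\<close>
  running through the letters of \<open>w\<close>.\<close>

definition T_word :: "nat list \<Rightarrow> (nat list \<Rightarrow>\<^sub>0 'k::field)" where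
  "T_word w = GC_map (F_word w)"

lemma T_word_Nil [simp]: "T_word [] = basis []"
  using GC_perm(1)[of "[]"] by (simp add: T_word_def)

lemma T_word_Cons: "n \<ge> 1 \<Longrightarrow> T_word (n # w) = bilinear_ext T_prod (basis [n]) (T_word w)"
  using perms_upt[of n] unfolding T_word_def F_word.simps
  by (subst GC_map_mult) (simp_all add: keys_F_word GC_upt del: upt_Suc One_nat_def)

lemma keys_GC_map:
  assumes "Poly_Mapping.keys x \<subseteq> perms"
  shows "Poly_Mapping.keys (GC_map x) \<subseteq> GC ` perms"
  unfolding GC_map_def by (rule keys_lin_ext) (use assms in auto)

lemma GC_in_lists: "s \<in> perms \<Longrightarrow> GC s \<in> lists {1..}"
  using GC_perm(1) composition_in_lists by blast

lemma keys_T_word: "Poly_Mapping.keys (T_word w :: nat list \<Rightarrow>\<^sub>0 'k::field) \<subseteq> lists {1..}"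
  using keys_GC_map[OF keys_F_word] GC_in_lists unfolding T_word_def by blast

lemma GC_map_Sym_map: "GC_map (Sym_map x) = lin_ext T_word x"
  by (rule module_hom_eq_on_keys[where f = x, OF module_hom_o[OF module_hom_GC_map module_hom_Sym_map]
      module_hom_lin_ext]) (simp add: Sym_map_def T_word_def)

lemma subspace_supported: "scaling.subspace {x. Poly_Mapping.keys x \<subseteq> B}"
  unfolding scaling.subspace_def by (simp add: keys_add_subset order_trans[OF keys_scale])

section \<open>The products of the generators form a basis\<close>

text \<open>For \<open>K = n # J\<close>, the vector \<open>basis K\<close> is isolated from
  \<open>T_prod [n] J\<close>. The measures express that \<open>J\<close> has a smaller sum, and
  that every other term has the same sum and either a larger first part or the same first part and
  more parts.\<close>

lemma basis_in_range:
  assumes "K \<in> lists {1..}"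
  shows "(basis K :: nat list \<Rightarrow>\<^sub>0 'k::field_char_0) \<in> lin_ext T_word ` {f. Poly_Mapping.keys f \<subseteq> lists {1..}}"
    (is "_ \<in> ?R")
  using assms
proof (induction K rule: wf_induct_rule[OF wf_measures[of
    "[sum_list, \<lambda>K. sum_list K - hd K, \<lambda>K. sum_list K - length K]"]])
  case (1 K)
  have R: "scaling.subspace ?R"
    by (rule module_hom.subspace_image[OF module_hom_lin_ext subspace_supported])
  show ?case
  proof (cases K)
    case Nil
    have "basis [] = (lin_ext T_word (basis []) :: nat list \<Rightarrow>\<^sub>0 'k)" by simp
    then show ?thesis unfolding Nil by (rule image_eqI) simp
  next
    case (Cons n J)
    then have J: "J \<in> lists {1..}" and n: "n \<ge> 1" using 1(2) by auto
    let ?T = "T_prod [n] J :: nat list \<Rightarrow>\<^sub>0 'k"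
    have "basis J \<in> ?R" using J n by (intro 1(1)) (auto simp: Cons)
    then obtain f :: "nat list \<Rightarrow>\<^sub>0 'k" where f: "basis J = lin_ext T_word f" "Poly_Mapping.keys f \<subseteq> lists {1..}"
      by blast
    have "?T = bilinear_ext T_prod (basis [n]) (lin_ext T_word f)"
      by (simp flip: f(1))
    \<comment> \<open>Multiplying by \<open>T_(n)\<close> on the left prefixes the letter
      \<open>n\<close> to every word, so the range is closed under it.\<close>
    also have "\<dots> = lin_ext T_word (lin_ext (\<lambda>w. basis (n # w)) f)"
      by (rule module_hom_eq_on_keys[where f = f])
        (simp_all add: module_hom_o[OF module_hom_bilinear_ext_right module_hom_lin_ext]
          module_hom_o[OF module_hom_lin_ext module_hom_lin_ext] T_word_Cons[OF n])
    also have "\<dots> \<in> ?R"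
      using f(2) n by (intro imageI CollectI keys_lin_ext) auto
    finally have TR: "?T \<in> ?R" .
    have other: "basis K' \<in> ?R" if "K' \<in> Poly_Mapping.keys ?T - {K}" for K'
    proof (rule 1(1))
      have "Poly_Mapping.lookup ?T K' \<noteq> 0" using that by (simp add: in_keys_iff)
      note supp = T_prod_row_support[OF J n this]
      show "K' \<in> lists {1..}" using supp(1) composition_in_lists by blast
      obtain h L where K': "K' = h # L" using supp(2) by (cases K') auto
      have len: "length K' \<le> sum_list K'" and sum: "sum_list K' = sum_list K"
        using supp(1) length_composition_le by (auto simp: sum_list_composition Cons)
      \<comment> \<open>With equal first parts, \<open>L\<close> refines \<open>J\<close> and
        differs from it, so it has more parts.\<close>
      have "length J < length L" if "h = n"
      proof -
        have L: "L \<in> compositions (sum_list J)" using supp(1) that by (simp add: K' compositions_Cons_iff)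
        have "L \<noteq> J" using \<open>K' \<in> _ - {K}\<close> that by (auto simp: K' Cons)
        then show ?thesis
          using descent_set_subset_length[OF _ L, of J] supp(4) J lists_iff_composition that
          by (force simp: K')
      qed
      then show "(K', K) \<in> measures [sum_list, \<lambda>K. sum_list K - hd K, \<lambda>K. sum_list K - length K]"
        using supp(3) len sum by (cases "h = n") (auto simp: K' Cons)
    qed
    define c where "c = Poly_Mapping.lookup ?T K"
    have c: "c \<noteq> 0" using T_prod_row_diagonal[OF J n] by (simp add: c_def Cons)
    have "?T = scale c (basis K) + (\<Sum>K'\<in>Poly_Mapping.keys ?T - {K}. scale (Poly_Mapping.lookup ?T K') (basis K'))"
      using basis_expansion[of ?T] c unfolding c_def
      by (metis (no_types, lifting) finite_keys in_keys_iff sum.remove)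
    then have "scale c (basis K) = ?T - (\<Sum>K'\<in>Poly_Mapping.keys ?T - {K}. scale (Poly_Mapping.lookup ?T K') (basis K'))"
      by (rule eq_diff_eq[THEN iffD2, OF sym])
    also have "\<dots> \<in> ?R"
      by (intro scaling.subspace_diff[OF R] TR scaling.subspace_sum[OF R] scaling.subspace_scale[OF R] other)
    \<comment> \<open>The diagonal coefficient \<open>c\<close> is invertible.\<close>
    finally have "scale (1 / c) (scale c (basis K)) \<in> ?R"
      by (rule scaling.subspace_scale[OF R])
    then show ?thesis using c by (simp del: image_iff)
  qed
qed

text \<open>Induction on a bound for the lengths of words. Among the words of \<open>f\<close>,
  those with least first letter \<open>n\<close> are kept and stripped of it; a shortest composition
  \<open>J\<close> in the image of the stripped part yields a nonzero coefficient at
  \<open>n # J\<close>.\<close>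

lemma lin_ext_T_word_eq_0:
  fixes f :: "nat list \<Rightarrow>\<^sub>0 'k::field_char_0"
  assumes "Poly_Mapping.keys f \<subseteq> lists {1..}" "lin_ext T_word f = 0"
  shows "f = 0"
proof -
  have "f = 0" if "Poly_Mapping.keys f \<subseteq> lists {1..}" "lin_ext T_word f = 0"
      "\<forall>w\<in>Poly_Mapping.keys f. length w < N" for N and f :: "nat list \<Rightarrow>\<^sub>0 'k"
    using that
  proof (induction N arbitrary: f)
    case 0
    then show ?case by auto
  next
    case (Suc N)
    show ?case
    proof (rule ccontr)
      assume "f \<noteq> 0"
      have lookup_lin: "Poly_Mapping.lookup (lin_ext m h) K =
          (\<Sum>w\<in>Poly_Mapping.keys h. Poly_Mapping.lookup h w * Poly_Mapping.lookup (m w) K)"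
        for m and h :: "nat list \<Rightarrow>\<^sub>0 'k" and K :: "nat list"
        by (simp add: lin_ext_def lookup_sum)
      have supp: "K \<noteq> [] \<and> n \<le> hd K"
        if "n \<ge> 1" "Poly_Mapping.lookup (T_word (n # w) :: nat list \<Rightarrow>\<^sub>0 'k) K \<noteq> 0" for n w K
      proof -
        have "Poly_Mapping.keys (T_word (n # w) :: nat list \<Rightarrow>\<^sub>0 'k) \<subseteq> {K. K \<noteq> [] \<and> n \<le> hd K}"
          unfolding T_word_Cons[OF that(1)]
        proof (rule keys_bilinear_ext[of "{[n]}" "lists {1..}"])
          show "Poly_Mapping.keys (T_prod u v :: nat list \<Rightarrow>\<^sub>0 'k) \<subseteq> {K. K \<noteq> [] \<and> n \<le> hd K}"
            if "u \<in> {[n]}" "v \<in> lists {1..}" for u v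
            using T_prod_row_support(2,3)[OF that(2) \<open>n \<ge> 1\<close>] that(1) by (auto simp: in_keys_iff)
        qed (use keys_T_word in auto)
        then show ?thesis using that(2) by (auto simp: in_keys_iff)
      qed
      have letters: "\<And>w. w \<in> Poly_Mapping.keys f \<Longrightarrow> w \<noteq> [] \<Longrightarrow> hd w \<ge> 1"
        using Suc.prems(1) by (metis atLeast_iff hd_in_set in_listsD subsetD)
      have Nil: "[] \<notin> Poly_Mapping.keys f"
      proof
        assume "[] \<in> Poly_Mapping.keys f"
        \<comment> \<open>Nonempty words only produce nonempty compositions, so the coefficient at
          \<open>[]\<close> is that of the empty word in \<open>f\<close>.\<close>
        have "0 = Poly_Mapping.lookup (lin_ext T_word f) []" using Suc.prems(2) by simp
        also have "\<dots> = (\<Sum>w\<in>Poly_Mapping.keys f. if w = [] then Poly_Mapping.lookup f [] else 0)"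
          unfolding lookup_lin
        proof (rule sum.cong[OF refl])
          fix w assume w: "w \<in> Poly_Mapping.keys f"
          show "Poly_Mapping.lookup f w * Poly_Mapping.lookup (T_word w) [] =
              (if w = [] then Poly_Mapping.lookup f [] else 0)"
            using supp[of "hd w" "tl w" "[]"] letters[OF w] by (cases w) (auto simp: lookup_basis)
        qed
        also have "\<dots> = Poly_Mapping.lookup f []"
          using \<open>[] \<in> _\<close> by simp
        finally show False using \<open>[] \<in> _\<close> by (simp add: in_keys_iff)
      qed
      define n where "n = Min (hd ` Poly_Mapping.keys f)"
      have "Poly_Mapping.keys f \<noteq> {}" using \<open>f \<noteq> 0\<close> by simp
      then have "n \<in> hd ` Poly_Mapping.keys f" and n_min: "\<And>w. w \<in> Poly_Mapping.keys f \<Longrightarrow> n \<le> hd w"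
        unfolding n_def by (auto intro: Min_in)
      then obtain v0 where v0: "n # v0 \<in> Poly_Mapping.keys f"
        using Nil by (metis imageE list.exhaust_sel)
      then have n: "n \<ge> 1" using letters by fastforce
      \<comment> \<open>\<open>g\<close> collects the words of \<open>f\<close> that start with
        \<open>n\<close>, with this letter removed.\<close>
      define g where "g = lin_ext (\<lambda>w. if hd w = n then basis (tl w) else 0) f"
      have g: "Poly_Mapping.lookup g v = Poly_Mapping.lookup f (n # v)" for v
      proof -
        have "Poly_Mapping.lookup g v = (\<Sum>w\<in>Poly_Mapping.keys f. if w = n # v then Poly_Mapping.lookup f (n # v) else 0)"
          unfolding g_def lookup_lin
        proof (rule sum.cong[OF refl])
          fix w assume w: "w \<in> Poly_Mapping.keys f"
          with Nil have "w \<noteq> []" by metis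
          then show "Poly_Mapping.lookup f w * Poly_Mapping.lookup (if hd w = n then basis (tl w) else 0) v =
              (if w = n # v then Poly_Mapping.lookup f (n # v) else 0)"
            by (cases w) (auto simp: lookup_basis)
        qed
        also have "\<dots> = Poly_Mapping.lookup f (n # v)"
          by (simp add: in_keys_iff)
        finally show ?thesis .
      qed
      then have keys_g: "v \<in> Poly_Mapping.keys g \<longleftrightarrow> n # v \<in> Poly_Mapping.keys f" for v
        by (simp add: in_keys_iff)
      define G where "G = lin_ext T_word g"
      have "G \<noteq> 0"
      proof
        assume "G = 0"
        \<comment> \<open>The words of \<open>g\<close> are shorter by one letter, so the induction
          hypothesis applies.\<close>
        then have "g = 0"
          using Suc.IH[of g] Suc.prems(1,3) keys_g unfolding G_def by fastforce
        then show False using v0 keys_g[of v0] by simp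
      qed
      then obtain J where J: "J \<in> Poly_Mapping.keys G"
          and J_min: "\<And>J'. J' \<in> Poly_Mapping.keys G \<Longrightarrow> length J \<le> length J'"
        using ex_has_least_nat[of "\<lambda>J. J \<in> Poly_Mapping.keys G" _ length] by fastforce
      have keys_G: "Poly_Mapping.keys G \<subseteq> lists {1..}"
        unfolding G_def by (rule keys_lin_ext) (rule keys_T_word)
      have first: "bilinear_ext T_prod (basis [n]) G = lin_ext (\<lambda>w. if hd w = n then T_word w else 0) f"
        unfolding G_def g_def
      proof (rule module_hom_eq_on_keys[where f = f])
        show "module_hom scale scale (\<lambda>f. bilinear_ext T_prod (basis [n])
            (lin_ext T_word (lin_ext (\<lambda>w. if hd w = n then basis (tl w) else 0) f)) :: nat list \<Rightarrow>\<^sub>0 'k)"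
          by (rule module_hom_o[OF module_hom_bilinear_ext_right module_hom_o[OF module_hom_lin_ext module_hom_lin_ext]])
        fix w assume "w \<in> Poly_Mapping.keys f"
        then have "w \<noteq> []" using Nil by metis
        then show "bilinear_ext T_prod (basis [n])
            (lin_ext T_word (lin_ext (\<lambda>w. if hd w = n then basis (tl w) else 0) (basis w))) =
            (lin_ext (\<lambda>w. if hd w = n then T_word w else 0) (basis w) :: nat list \<Rightarrow>\<^sub>0 'k)"
          using n by (cases w) (auto simp: T_word_Cons[OF n] module_hom.zero[OF module_hom_lin_ext]
            module_hom.zero[OF module_hom_bilinear_ext_right])
      qed (rule module_hom_lin_ext)
      have "0 = Poly_Mapping.lookup (lin_ext T_word f) (n # J)" using Suc.prems(2) by simp
      \<comment> \<open>Words with a larger first letter only produce compositions with a larger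
        first part.\<close>
      also have "\<dots> = Poly_Mapping.lookup (lin_ext (\<lambda>w. if hd w = n then T_word w else 0) f) (n # J)"
        unfolding lookup_lin
      proof (rule sum.cong[OF refl])
        fix w assume w: "w \<in> Poly_Mapping.keys f"
        then have "w \<noteq> []" using Nil by metis
        then show "Poly_Mapping.lookup f w * Poly_Mapping.lookup (T_word w) (n # J) =
            Poly_Mapping.lookup f w * Poly_Mapping.lookup (if hd w = n then T_word w else 0) (n # J)"
          using supp[of "hd w" "tl w" "n # J"] letters[OF w] n_min[OF w] by force
      qed
      also have "\<dots> = Poly_Mapping.lookup (lin_ext (T_prod [n]) G) (n # J)"
        unfolding first[symmetric] by (simp add: bilinear_ext_eq)
      also have "\<dots> = (\<Sum>J'\<in>Poly_Mapping.keys G. if J' = J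
          then Poly_Mapping.lookup G J * Poly_Mapping.lookup (T_prod [n] J) (n # J) else 0)"
        unfolding lookup_lin
      proof (rule sum.cong[OF refl])
        fix J' assume J': "J' \<in> Poly_Mapping.keys G"
        \<comment> \<open>If \<open>J'\<close> contributed to \<open>n # J\<close>, then
          \<open>J\<close> would refine \<open>J'\<close>; since \<open>J\<close> is shortest, both
          would be equal.\<close>
        have "Poly_Mapping.lookup (T_prod [n] J' :: nat list \<Rightarrow>\<^sub>0 'k) (n # J) = 0" if "J' \<noteq> J"
        proof (rule ccontr)
          assume nz: "Poly_Mapping.lookup (T_prod [n] J' :: nat list \<Rightarrow>\<^sub>0 'k) (n # J) \<noteq> 0"
          have lists: "J' \<in> lists {1..}" using J' keys_G by blast
          note supp = T_prod_row_support[OF lists n nz]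
          have "J \<in> compositions (sum_list J')" "descent_set J' \<subseteq> descent_set J"
            using supp(1,4) by (simp_all add: compositions_Cons_iff)
          moreover have "J' \<in> compositions (sum_list J')" using lists lists_iff_composition by blast
          ultimately show False
            using descent_set_subset_length[of J' "sum_list J'" J] J_min[OF J'] that by fastforce
        qed
        then show "Poly_Mapping.lookup G J' * Poly_Mapping.lookup (T_prod [n] J') (n # J) =
            (if J' = J then Poly_Mapping.lookup G J * Poly_Mapping.lookup (T_prod [n] J) (n # J) else 0)"
          by auto
      qed
      also have "\<dots> = Poly_Mapping.lookup G J * Poly_Mapping.lookup (T_prod [n] J) (n # J)"
        using J by simp
      finally have "Poly_Mapping.lookup (T_prod [n] J :: nat list \<Rightarrow>\<^sub>0 'k) (n # J) = 0"
        using J by (simp add: in_keys_iff)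
      moreover have "J \<in> lists {1..}" using J keys_G by blast
      ultimately show False using T_prod_row_diagonal[OF _ n] by blast
    qed
  qed
  moreover have "\<forall>w\<in>Poly_Mapping.keys f. length w < Suc (Max (length ` Poly_Mapping.keys f))"
    by (simp add: less_Suc_eq_le)
  ultimately show ?thesis using assms by blast
qed

section \<open>The quotient algebra\<close>

lemma Sym_simps [simp]:
  "carrier Sym = {f. Poly_Mapping.keys f \<subseteq> lists {1..}}"
  "monoid.mult Sym = bilinear_ext (\<lambda>u v. basis (u @ v))"
  "one Sym = basis []"
  "zero Sym = 0"
  "add Sym = (+)"
  "smult Sym = scale"
  by (simp_all add: Sym_def free_algebra_def)

lemma ring_Sym: "ring (Sym :: ('k::field, nat list \<Rightarrow>\<^sub>0 'k) module)"
  unfolding Sym_def free_algebra_def by (rule ring_based_algebra) auto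

lemma bij_betw_T_word:
  "bij_betw (lin_ext T_word) {f :: nat list \<Rightarrow>\<^sub>0 'k::field_char_0. Poly_Mapping.keys f \<subseteq> lists {1..}}
    {f. Poly_Mapping.keys f \<subseteq> lists {1..}}"
proof (rule bij_betw_imageI)
  let ?C = "{f :: nat list \<Rightarrow>\<^sub>0 'k. Poly_Mapping.keys f \<subseteq> lists {1..}}"
  show "inj_on (lin_ext T_word) ?C"
  proof (rule inj_onI)
    fix f g assume "f \<in> ?C" "g \<in> ?C" and eq: "lin_ext T_word f = lin_ext T_word g"
    then have "Poly_Mapping.keys (f - g) \<subseteq> lists {1..}" by (simp add: keys_diff_subset)
    moreover have "lin_ext T_word (f - g) = 0"
      using eq by (simp add: module_hom.diff[OF module_hom_lin_ext])
    ultimately show "f = g" using lin_ext_T_word_eq_0 by fastforce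
  qed
  show "lin_ext T_word ` ?C = ?C"
  proof (intro subset_antisym subsetI)
    fix x assume "x \<in> lin_ext T_word ` ?C"
    then show "x \<in> ?C" by (auto simp only: mem_Collect_eq intro!: keys_lin_ext keys_T_word)
  next
    fix x assume "x \<in> ?C"
    then have x: "Poly_Mapping.keys x \<subseteq> lists {1..}" by simp
    have "scaling.subspace (lin_ext T_word ` ?C)"
      by (rule module_hom.subspace_image[OF module_hom_lin_ext subspace_supported])
    then have "(\<Sum>u\<in>Poly_Mapping.keys x. scale (Poly_Mapping.lookup x u) (basis u)) \<in> lin_ext T_word ` ?C"
      using x by (intro scaling.subspace_sum scaling.subspace_scale basis_in_range) blast+
    then show "x \<in> lin_ext T_word ` ?C"
      using basis_expansion[of x] by metis
  qed
qed

text \<open>Follows from spanning: \<open>basis I\<close> is the image under \<open>GC_map\<close>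
  of an element of \<open>FQSym\<close>, so \<open>I\<close> is a G-composition of some permutation
  in its support. The rationals serve as an auxiliary field of characteristic zero.\<close>

lemma ex_perm_GC:
  assumes "I \<in> lists {1..}"
  shows "\<exists>s\<in>perms. GC s = I"
proof -
  have "(basis I :: nat list \<Rightarrow>\<^sub>0 rat) \<in> lin_ext T_word ` {f. Poly_Mapping.keys f \<subseteq> lists {1..}}"
    by (rule basis_in_range[OF assms])
  then obtain f :: "nat list \<Rightarrow>\<^sub>0 rat" where "basis I = GC_map (Sym_map f)"
    unfolding GC_map_Sym_map by blast
  then have "I \<in> Poly_Mapping.keys (GC_map (Sym_map f))"
    by (metis keys_basis singletonI)
  then show ?thesis using keys_GC_map[OF keys_Sym_map] by blast
qed

section \<open>Classes and operations of the quotient\<close>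

abbreviation T_class :: "(nat list \<Rightarrow>\<^sub>0 'k::field) \<Rightarrow> (nat list \<Rightarrow>\<^sub>0 'k) set" where
  "T_class x \<equiv> GC_ideal +>\<^bsub>FQSym\<^esub> x"

lemma T_class_eq_iff:
  "Poly_Mapping.keys x \<subseteq> perms \<Longrightarrow> Poly_Mapping.keys y \<subseteq> perms \<Longrightarrow> T_class x = T_class y \<longleftrightarrow> GC_map x = GC_map y"
  by (auto simp: GC_ideal_coset)

lemma T_alg_simps:
  "carrier T_alg = carrier (FQSym Quot GC_ideal)"
  "monoid.mult T_alg = monoid.mult (FQSym Quot GC_ideal)"
  "one T_alg = one (FQSym Quot GC_ideal)"
  "zero T_alg = zero (FQSym Quot GC_ideal)"
  "add T_alg = add (FQSym Quot GC_ideal)"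
  by (simp_all add: T_alg_def quot_algebra_def ring.defs module.defs FactRing_def)

lemma T_class_in_carrier: "Poly_Mapping.keys x \<subseteq> perms \<Longrightarrow> T_class x \<in> carrier T_alg"
  by (auto simp: T_alg_simps FactRing_def A_RCOSETS_def')

text \<open>Linearity of \<open>GC_map\<close> makes the cosets in the defining union all equal, so
  the union is a single class.\<close>

lemma T_alg_smult:
  assumes "Poly_Mapping.keys x \<subseteq> perms"
  shows "c \<odot>\<^bsub>T_alg\<^esub> T_class x = T_class (scale c x)"
proof -
  have "c \<odot>\<^bsub>T_alg\<^esub> T_class x = (\<Union>y\<in>T_class x. T_class (scale c y))"
    by (simp add: T_alg_def quot_algebra_def ring.defs module.defs FactRing_def)
  also have "\<dots> = (\<Union>y\<in>T_class x. T_class (scale c x))"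
  proof (rule SUP_cong[OF refl])
    fix y assume "y \<in> T_class x"
    then have "Poly_Mapping.keys y \<subseteq> perms" "GC_map y = GC_map x"
      using assms by (auto simp: GC_ideal_coset)
    then show "T_class (scale c y) = T_class (scale c x)"
      using assms by (simp add: T_class_eq_iff order_trans[OF keys_scale] GC_map_scale)
  qed
  also have "\<dots> = T_class (scale c x)"
    using assms by (auto simp: GC_ideal_coset)
  finally show ?thesis .
qed

text \<open>\<open>T_alg\<close> is a record with a scalar multiplication added; its ring operations
  are those of the quotient ring, whose axioms carry over.\<close>

lemma ring_T_alg: "ring (T_alg :: ('k::field, (nat list \<Rightarrow>\<^sub>0 'k) set) module)"
proof -
  interpret ring "FQSym Quot GC_ideal :: (nat list \<Rightarrow>\<^sub>0 'k) set ring"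
    by (rule ideal.quotient_is_ring[OF ideal_GC_ideal])
  have "\<exists>y\<in>carrier (FQSym Quot GC_ideal). y \<oplus>\<^bsub>FQSym Quot GC_ideal\<^esub> x = \<zero>\<^bsub>FQSym Quot GC_ideal\<^esub>"
    if "x \<in> carrier (FQSym Quot GC_ideal)" for x :: "(nat list \<Rightarrow>\<^sub>0 'k) set"
    using that l_neg a_inv_closed by blast
  then show ?thesis
    by (intro ringI abelian_groupI monoidI; simp only: T_alg_simps)
      (simp_all add: a_ac m_assoc l_distr r_distr)
qed

lemma T_class_ring_hom: "T_class \<in> ring_hom FQSym T_alg"
proof -
  have "T_class \<in> ring_hom FQSym (FQSym Quot GC_ideal)"
    by (rule ideal.rcos_ring_hom[OF ideal_GC_ideal])
  then show ?thesis by (simp add: ring_hom_def T_alg_simps)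
qed

section \<open>The isomorphism with noncommutative symmetric functions\<close>

lemma Sym_map_one: "Sym_map (basis []) = basis []"
  by (simp add: Sym_map_def)

text \<open>Classes are compared by \<open>GC_map\<close>, and \<open>GC_map\<close> after
  \<open>Sym_map\<close> is \<open>lin_ext T_word\<close>; bijectivity thus reduces to
  \<open>bij_betw_T_word\<close>.\<close>

lemma T_class_Sym_map_iso:
  "(\<lambda>x. T_class (Sym_map x)) \<in> ring_iso Sym (T_alg :: ('k::field_char_0, (nat list \<Rightarrow>\<^sub>0 'k) set) module)"
proof -
  let ?S = "Sym :: ('k, nat list \<Rightarrow>\<^sub>0 'k) module"
  have "Sym_map \<in> ring_hom ?S FQSym"
    by (rule ring_hom_memI)
      (simp_all add: keys_Sym_map Sym_map_mult module_hom.add[OF module_hom_Sym_map] Sym_map_one)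
  then have "(\<lambda>x. T_class (Sym_map x)) \<in> ring_hom ?S T_alg"
    using ring_hom_trans[OF _ T_class_ring_hom] by (simp add: o_def)
  moreover have "bij_betw (\<lambda>x. T_class (Sym_map x)) (carrier ?S) (carrier T_alg)"
  proof (rule bij_betw_imageI)
    show "inj_on (\<lambda>x. T_class (Sym_map x)) (carrier ?S)"
      using bij_betw_T_word[where 'k = 'k]
      by (auto simp: inj_on_def bij_betw_def T_class_eq_iff[OF keys_Sym_map keys_Sym_map] GC_map_Sym_map)
    show "(\<lambda>x. T_class (Sym_map x)) ` carrier ?S = carrier T_alg"
    proof (intro subset_antisym subsetI)
      fix X assume "X \<in> (\<lambda>x. T_class (Sym_map x)) ` carrier ?S"
      then show "X \<in> carrier T_alg" using T_class_in_carrier[OF keys_Sym_map] by blast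
    next
      fix X :: "(nat list \<Rightarrow>\<^sub>0 'k) set" assume "X \<in> carrier T_alg"
      then obtain x where x: "Poly_Mapping.keys x \<subseteq> perms" "X = T_class x"
        by (auto simp: T_alg_simps FactRing_def A_RCOSETS_def')
      have "GC_map x \<in> {f. Poly_Mapping.keys f \<subseteq> lists {1..}}"
        using keys_GC_map[OF x(1)] GC_in_lists by auto
      then obtain f :: "nat list \<Rightarrow>\<^sub>0 'k" where f: "Poly_Mapping.keys f \<subseteq> lists {1..}" "GC_map x = lin_ext T_word f"
        using bij_betw_T_word[where 'k = 'k] unfolding bij_betw_def by (metis (no_types, lifting) imageE mem_Collect_eq)
      then have "X = T_class (Sym_map f)"
        by (simp add: x T_class_eq_iff keys_Sym_map GC_map_Sym_map)
      then show "X \<in> (\<lambda>x. T_class (Sym_map x)) ` carrier ?S" using f(1) by simp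
    qed
  qed
  ultimately show ?thesis by (simp add: ring_iso_def)
qed

lemma ex_algebra_iso:
  "\<exists>h. h \<in> algebra_iso (T_alg :: ('k::field_char_0, (nat list \<Rightarrow>\<^sub>0 'k) set) module) Sym"
proof -
  let ?S = "Sym :: ('k, nat list \<Rightarrow>\<^sub>0 'k) module" and ?g = "\<lambda>x :: nat list \<Rightarrow>\<^sub>0 'k. T_class (Sym_map x)"
  define h where "h = inv_into (carrier ?S) ?g"
  have iso: "?g \<in> ring_iso ?S T_alg" by (rule T_class_Sym_map_iso)
  then have bij: "bij_betw ?g (carrier ?S) (carrier T_alg)" by (simp add: ring_iso_def)
  have h_inv: "h (T_class (Sym_map y)) = y" if "y \<in> carrier ?S" for y
    unfolding h_def by (rule bij_betw_inv_into_left[OF bij that])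
  have "h (c \<odot>\<^bsub>T_alg\<^esub> X) = c \<odot>\<^bsub>Sym\<^esub> h X" if X: "X \<in> carrier T_alg" for c X
  proof -
    obtain f where f: "f \<in> carrier ?S" "X = ?g f"
      using bij X unfolding bij_betw_def by blast
    have "c \<odot>\<^bsub>T_alg\<^esub> X = ?g (scale c f)"
      using f(2) by (simp add: T_alg_smult keys_Sym_map module_hom.scale[OF module_hom_Sym_map])
    moreover have "scale c f \<in> carrier ?S"
      using f(1) by (simp add: order_trans[OF keys_scale])
    ultimately show ?thesis
      using f by (simp only: h_inv Sym_simps(6))
  qed
  moreover have "h \<in> ring_iso T_alg ?S"
    unfolding h_def by (rule ring_iso_set_sym[OF ring_Sym iso])
  ultimately show ?thesis unfolding algebra_iso_def by blast
qed

section \<open>Products of the basis classes\<close>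

text \<open>Permutations with equal G-composition have equal coordinates, so the description in
  \<open>T_basis\<close> denotes one class.\<close>

lemma T_basis_eq:
  assumes "s \<in> perms"
  shows "T_basis (GC s) = T_class (basis s :: nat list \<Rightarrow>\<^sub>0 'k::field)"
  unfolding T_basis_def
proof (rule the_equality)
  show "\<exists>s'\<in>perms. GC s' = GC s \<and> T_class (basis s) = T_class (basis s' :: nat list \<Rightarrow>\<^sub>0 'k)"
    using assms by blast
  show "X = T_class (basis s)"
    if "\<exists>s'\<in>perms. GC s' = GC s \<and> X = T_class (basis s' :: nat list \<Rightarrow>\<^sub>0 'k)" for X
  proof -
    from that obtain s' where "s' \<in> perms" "GC s' = GC s" "X = T_class (basis s')" by blast
    then show ?thesis using assms by (simp add: T_class_eq_iff)
  qed
qed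

lemma finsum_T_class:
  assumes "finite A" "\<And>i. i \<in> A \<Longrightarrow> Poly_Mapping.keys (f i) \<subseteq> perms"
  shows "(\<Oplus>\<^bsub>T_alg\<^esub>i\<in>A. T_class (f i :: nat list \<Rightarrow>\<^sub>0 'k::field)) = T_class (sum f A)"
proof -
  interpret T: ring "T_alg :: ('k, (nat list \<Rightarrow>\<^sub>0 'k) set) module" by (rule ring_T_alg)
  interpret hom: ring_hom_ring "FQSym :: ('k, nat list \<Rightarrow>\<^sub>0 'k) module" T_alg T_class
    by (rule ring_hom_ringI2[OF ring_FQSym ring_T_alg T_class_ring_hom])
  show ?thesis
    using assms
  proof (induction A)
    case empty
    then show ?case using hom.hom_zero by simp
  next
    case (insert i A)
    have "(\<Oplus>\<^bsub>T_alg\<^esub>i\<in>insert i A. T_class (f i)) = T_class (f i) \<oplus>\<^bsub>T_alg\<^esub> T_class (sum f A)"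
      using insert by (subst T.finsum_insert) (auto simp: T_class_in_carrier)
    also have "\<dots> = T_class (f i + sum f A)"
      using insert.prems hom.hom_add[of "f i" "sum f A"] keys_sum_subset[of A f perms] by simp
    finally show ?case using insert by simp
  qed
qed

theorem theorem4p1:
  shows "ideal GC_ideal (FQSym :: ('k::field_char_0, nat list \<Rightarrow>\<^sub>0 'k) module)
    \<and> (\<exists>h. h \<in> algebra_iso (T_alg :: ('k, (nat list \<Rightarrow>\<^sub>0 'k) set) module) Sym)
    \<and> (\<forall>m n. \<forall>I\<in>compositions m. \<forall>J\<in>compositions n.
         (T_basis I :: (nat list \<Rightarrow>\<^sub>0 'k) set) \<otimes>\<^bsub>T_alg\<^esub> T_basis J =
         (\<Oplus>\<^bsub>T_alg\<^esub>K\<in>compositions (m + n). of_nat (T_coeff I J K) \<odot>\<^bsub>T_alg\<^esub> T_basis K))"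
proof (intro conjI allI ballI)
  fix m n I J
  assume I: "I \<in> compositions m" and J: "J \<in> compositions n"
  define rep where "rep K = (SOME s. s \<in> perms \<and> GC s = K)" for K
  have rep: "rep K \<in> perms" "GC (rep K) = K" if "K \<in> compositions k" for K k
    using someI_ex[of "\<lambda>s. s \<in> perms \<and> GC s = K"] ex_perm_GC[OF composition_in_lists[OF that]]
    by (auto simp: rep_def)
  have T_basis: "T_basis K = T_class (basis (rep K) :: nat list \<Rightarrow>\<^sub>0 'k)" if "K \<in> compositions k" for K k
    using T_basis_eq[OF rep(1)[OF that]] rep(2)[OF that] by simp
  let ?f = "\<lambda>K. scale (of_nat (T_coeff I J K)) (basis (rep K)) :: nat list \<Rightarrow>\<^sub>0 'k"
  have keys: "Poly_Mapping.keys (?f K) \<subseteq> perms" if "K \<in> compositions (m + n)" for K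
    using rep(1)[OF that] by (intro order_trans[OF keys_scale]) simp
  note IJ = rep[OF I] rep[OF J]
  have "(T_basis I :: (nat list \<Rightarrow>\<^sub>0 'k) set) \<otimes>\<^bsub>T_alg\<^esub> T_basis J = T_class (F_prod (rep I) (rep J))"
    using ring_hom_mult[OF T_class_ring_hom, of "basis (rep I) :: nat list \<Rightarrow>\<^sub>0 'k" "basis (rep J)"] IJ
    by (simp add: T_basis[OF I] T_basis[OF J])
  \<comment> \<open>Both representatives have coordinates \<open>T_prod I J\<close>, hence the same
    class.\<close>
  also have "\<dots> = T_class (sum ?f (compositions (m + n)))"
  proof (subst T_class_eq_iff)
    show "Poly_Mapping.keys (F_prod (rep I) (rep J) :: nat list \<Rightarrow>\<^sub>0 'k) \<subseteq> perms"
      by (rule keys_F_prod) (rule IJ)+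
    show "Poly_Mapping.keys (sum ?f (compositions (m + n))) \<subseteq> perms"
      using keys by (rule keys_sum_subset)
    have "GC_map (F_prod (rep I) (rep J)) = (T_prod I J :: nat list \<Rightarrow>\<^sub>0 'k)"
      using GC_map_F_prod[OF IJ(1,3)] IJ(2,4) by simp
    also have "\<dots> = GC_map (sum ?f (compositions (m + n)))"
      using I J by (simp add: T_prod_def GC_map_sum GC_map_scale rep(2) sum_list_composition)
    finally show "GC_map (F_prod (rep I) (rep J)) = GC_map (sum ?f (compositions (m + n)))" .
  qed
  also have "\<dots> = (\<Oplus>\<^bsub>T_alg\<^esub>K\<in>compositions (m + n). T_class (?f K))"
    using keys by (intro finsum_T_class[symmetric]) simp_all
  also have "\<dots> = (\<Oplus>\<^bsub>T_alg\<^esub>K\<in>compositions (m + n). of_nat (T_coeff I J K) \<odot>\<^bsub>T_alg\<^esub> T_basis K)"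
  proof -
    interpret T: ring "T_alg :: ('k, (nat list \<Rightarrow>\<^sub>0 'k) set) module" by (rule ring_T_alg)
    show ?thesis
      using keys by (intro T.finsum_cong') (auto simp: T_class_in_carrier T_basis T_alg_smult rep(1))
  qed
  finally show "(T_basis I :: (nat list \<Rightarrow>\<^sub>0 'k) set) \<otimes>\<^bsub>T_alg\<^esub> T_basis J =
    (\<Oplus>\<^bsub>T_alg\<^esub>K\<in>compositions (m + n). of_nat (T_coeff I J K) \<odot>\<^bsub>T_alg\<^esub> T_basis K)" .
qed (rule ideal_GC_ideal ex_algebra_iso)+

end
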